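(* Let $\Omega\subseteq\mathbb{R}^d$ be an open, bounded, connected set with Lipschitz boundary, with Sobolev--Korn constant $C_{\mathrm{BD}}>0$, and let $\alpha,\beta>0$ be such that $\beta/\alpha>C_{\mathrm{BD}}$. Then for every $u\in\mathrm{BV}(\Omega)$ $$\mathrm{TGV}^2_{\beta,\alpha}(u)=\alpha\,\|Du-m_{\mathcal{E}}(\nabla u)\|_{\mathcal M},$$ where $m_{\mathcal{E}}(\nabla u)$ denotes any minimiser of $w\mapsto\|\nabla u-w\|_{L^1(\Omega;\mathbb{R}^d)}$ over $w\in\mathrm{Ker}\,\mathcal{E}$.
   Context: For an $\mathbb{R}^\ell$-valued distribution $\mathcal T$ on $\Omega$, the Radon norm is $\|\mathcal T\|_{\mathcal M}=\sup\{\langle \mathcal T,v\rangle: v\in C_c^\infty(\Omega;\mathbb{R}^\ell),\ \|v\|_\infty\le 1\}$ (Euclidean norm pointwise; matrices are identified with vectors). $\mathrm{BV}(\Omega)$ is the space of $u\in L^1(\Omega)$ whose distributional derivative $Du$ is a finite Radon measure; $Du=\nabla u\,\mathcal{L}^d+D^su$ is its Lebesgue decomposition, $\nabla u$ being the density of the absolutely continuous part. $\mathrm{BD}(\Omega)$ is the space of $w\in L^1(\Omega;\mathbb{R}^d)$ whose symmetrised distributional gradient $\mathcal{E}w=\frac12(Dw+Dw^{T})$ is an $\mathbb{R}^{d\times d}$-valued finite Radon measure. Functions $w$ are identified with the measures $w\mathcal{L}^d$. For $\alpha,\beta>0$ and $u\in L^1(\Omega)$, $$\mathrm{TGV}^2_{\beta,\alpha}(u)=\min_{w\in\mathrm{BD}(\Omega)}\alpha\|Du-w\|_{\mathcal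 M}+\beta\|\mathcal{E}w\|_{\mathcal M}.$$ $\mathrm{Ker}\,\mathcal{E}$ is the set of functions $r(x)=Ax+b$ with $b\in\mathbb{R}^d$ and $A\in\mathbb{R}^{d\times d}$ skew-symmetric. The Sobolev--Korn constant $C_{\mathrm{BD}}>0$ of $\Omega$ is a constant depending only on $\Omega$ such that for every $w\in\mathrm{BD}(\Omega)$ there is $r_w\in\mathrm{Ker}\,\mathcal{E}$ with $\|w-r_w\|_{L^1(\Omega)}\le C_{\mathrm{BD}}\|\mathcal{E}w\|_{\mathcal M}$. *)

theory Defs
  imports "HOL-Analysis.Analysis"
begin

section \<open>Domains\<close>

text \<open>Near each boundary point \<^term>\<open>\<Omega>\<close> is the strict epigraph, in some unit direction \<open>\<nu>\<close>, of a
  Lipschitz function \<open>\<phi>\<close> on the hyperplane orthogonal to \<open>\<nu>\<close>;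
  \<open>y - (y \<bullet> \<nu>) *\<^sub>R \<nu>\<close> is the projection of \<open>y\<close> onto that hyperplane.\<close>

definition lipschitz_boundary :: "(real^'n) set \<Rightarrow> bool" where
  "lipschitz_boundary \<Omega> \<longleftrightarrow>
     (\<forall>p\<in>frontier \<Omega>. \<exists>r>0. \<exists>\<nu> L \<phi>. norm \<nu> = 1 \<and> L-lipschitz_on {y. y \<bullet> \<nu> = 0} \<phi> \<and>
        (\<forall>y\<in>ball p r. y \<in> \<Omega> \<longleftrightarrow> \<phi> (y - (y \<bullet> \<nu>) *\<^sub>R \<nu>) < y \<bullet> \<nu>))"


section \<open>Test functions and distributions\<close>

definition partial_deriv :: "'n \<Rightarrow> (real^'n \<Rightarrow> 'v::real_normed_vector) \<Rightarrow> real^'n \<Rightarrow> 'v" where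
  "partial_deriv j f = (\<lambda>x. frechet_derivative f (at x) (axis j 1))"

primrec Ck :: "nat \<Rightarrow> (real^'n \<Rightarrow> 'v::real_normed_vector) \<Rightarrow> bool" where
  "Ck 0 f \<longleftrightarrow> continuous_on UNIV f"
| "Ck (Suc k) f \<longleftrightarrow> (\<forall>x. f differentiable (at x)) \<and> (\<forall>j. Ck k (partial_deriv j f))"

definition test_function :: "(real^'n) set \<Rightarrow> (real^'n \<Rightarrow> 'v::real_normed_vector) \<Rightarrow> bool" where
  "test_function \<Omega> v \<longleftrightarrow> (\<forall>k. Ck k v) \<and>
     compact (closure {x. v x \<noteq> 0}) \<and> closure {x. v x \<noteq> 0} \<subseteq> \<Omega>"

text \<open>Distributions with values in a Euclidean space \<^typ>\<open>'v\<close> are represented by their action on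
  test functions; only the values on test functions matter. For matrices, \<open>\<bullet>\<close> and \<^const>\<open>norm\<close>
  on \<^typ>\<open>real^'n^'n\<close> are the Frobenius inner product and norm.\<close>

type_synonym ('n, 'v) distribution = "(real^'n \<Rightarrow> 'v) \<Rightarrow> real"

definition radon_norm :: "(real^'n) set \<Rightarrow> ('n, 'v::euclidean_space) distribution \<Rightarrow> ereal" where
  "radon_norm \<Omega> T = (SUP v\<in>{v. test_function \<Omega> v \<and> (\<forall>x. norm (v x) \<le> 1)}. ereal (T v))"

definition fun_dist :: "(real^'n) set \<Rightarrow> (real^'n \<Rightarrow> 'v::euclidean_space) \<Rightarrow> ('n, 'v) distribution" where
  "fun_dist \<Omega> w = (\<lambda>v. LINT x|lebesgue_on \<Omega>. w x \<bullet> v x)"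

definition dist_grad :: "(real^'n) set \<Rightarrow> (real^'n \<Rightarrow> real) \<Rightarrow> ('n, real^'n) distribution" where
  "dist_grad \<Omega> u = (\<lambda>v. - (LINT x|lebesgue_on \<Omega>. u x * (\<Sum>j\<in>UNIV. partial_deriv j v x $ j)))"

text \<open>\<open>(Dw)\<^sub>i\<^sub>j = \<partial>\<^sub>j w\<^sub>i\<close>.\<close>

definition dist_jacobian :: "(real^'n) set \<Rightarrow> (real^'n \<Rightarrow> real^'n) \<Rightarrow> ('n, real^'n^'n) distribution" where
  "dist_jacobian \<Omega> w =
     (\<lambda>V. - (LINT x|lebesgue_on \<Omega>. (\<Sum>i\<in>UNIV. \<Sum>j\<in>UNIV. w x $ i * partial_deriv j V x $ i $ j)))"

text \<open>The transpose of a matrix-valued distribution \<open>T\<close> acts by \<open>V \<mapsto> T (V\<^sup>T)\<close>.\<close>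

definition sym_grad :: "(real^'n) set \<Rightarrow> (real^'n \<Rightarrow> real^'n) \<Rightarrow> ('n, real^'n^'n) distribution" where
  "sym_grad \<Omega> w = (\<lambda>V. (dist_jacobian \<Omega> w V + dist_jacobian \<Omega> w (\<lambda>x. transpose (V x))) / 2)"


section \<open>Vector-valued finite Radon measures\<close>

abbreviation borel_subsets :: "(real^'n) set \<Rightarrow> (real^'n) set set" where
  "borel_subsets \<Omega> \<equiv> sets (restrict_space borel \<Omega>)"

text \<open>On an open subset of \<open>\<real>\<^sup>d\<close> every finite Borel measure is Radon, so finite vector-valued Radon
  measures are the countably additive set functions on the Borel subsets.\<close>

definition vector_measure :: "(real^'n) set \<Rightarrow> ((real^'n) set \<Rightarrow> 'v::euclidean_space) \<Rightarrow> bool" where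
  "vector_measure \<Omega> m \<longleftrightarrow>
     (\<forall>A :: nat \<Rightarrow> (real^'n) set. range A \<subseteq> borel_subsets \<Omega> \<longrightarrow> disjoint_family A \<longrightarrow>
        (\<lambda>k. m (A k)) sums m (\<Union>k. A k))"

text \<open>The positive part \<open>\<mu>\<^sup>+\<close> in the Jordan decomposition of a finite signed measure \<open>\<mu>\<close>.\<close>

definition positive_part :: "(real^'n) set \<Rightarrow> ((real^'n) set \<Rightarrow> real) \<Rightarrow> (real^'n) measure" where
  "positive_part \<Omega> \<mu> = measure_of \<Omega> (borel_subsets \<Omega>)
     (\<lambda>A. SUP B\<in>{B\<in>borel_subsets \<Omega>. B \<subseteq> A}. ennreal (\<mu> B))"

text \<open>\<open>\<integral> v \<cdot> dm\<close>, where each component of \<open>m\<close> is split as \<open>\<mu>\<^sup>+ - (- \<mu>)\<^sup>+\<close>.\<close>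

definition measure_integral ::
    "(real^'n) set \<Rightarrow> ((real^'n) set \<Rightarrow> 'v::euclidean_space) \<Rightarrow> ('n, 'v) distribution" where
  "measure_integral \<Omega> m = (\<lambda>v. \<Sum>b\<in>Basis.
     (LINT x|positive_part \<Omega> (\<lambda>A. m A \<bullet> b). v x \<bullet> b) -
     (LINT x|positive_part \<Omega> (\<lambda>A. - (m A \<bullet> b)). v x \<bullet> b))"

definition represented_by ::
    "(real^'n) set \<Rightarrow> ('n, 'v::euclidean_space) distribution \<Rightarrow> ((real^'n) set \<Rightarrow> 'v) \<Rightarrow> bool" where
  "represented_by \<Omega> T m \<longleftrightarrow>
     vector_measure \<Omega> m \<and> (\<forall>v. test_function \<Omega> v \<longrightarrow> T v = measure_integral \<Omega> m v)"

definition lebesgue_singular :: "(real^'n) set \<Rightarrow> ((real^'n) set \<Rightarrow> 'v::euclidean_space) \<Rightarrow> bool" where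
  "lebesgue_singular \<Omega> s \<longleftrightarrow>
     (\<exists>N\<in>borel_subsets \<Omega>. emeasure lborel N = 0 \<and> (\<forall>A\<in>borel_subsets \<Omega>. A \<inter> N = {} \<longrightarrow> s A = 0))"


section \<open>Functions of bounded variation and of bounded deformation\<close>

definition BV :: "(real^'n) set \<Rightarrow> (real^'n \<Rightarrow> real) set" where
  "BV \<Omega> = {u. integrable (lebesgue_on \<Omega>) u \<and> (\<exists>m. represented_by \<Omega> (dist_grad \<Omega> u) m)}"

definition BD :: "(real^'n) set \<Rightarrow> (real^'n \<Rightarrow> real^'n) set" where
  "BD \<Omega> = {w. integrable (lebesgue_on \<Omega>) w \<and> (\<exists>m. represented_by \<Omega> (sym_grad \<Omega> w) m)}"

text \<open>The density of the absolutely continuous part of \<open>Du\<close>. It is determined only up to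
  Lebesgue-null sets, and \<^const>\<open>Eps\<close> picks a version.\<close>

definition ac_gradient :: "(real^'n) set \<Rightarrow> (real^'n \<Rightarrow> real) \<Rightarrow> (real^'n \<Rightarrow> real^'n)" where
  "ac_gradient \<Omega> u = (SOME g. integrable (lebesgue_on \<Omega>) g \<and>
     (\<exists>m s. represented_by \<Omega> (dist_grad \<Omega> u) m \<and> vector_measure \<Omega> s \<and> lebesgue_singular \<Omega> s \<and>
        (\<forall>A\<in>borel_subsets \<Omega>. m A = (LINT x|lebesgue_on A. g x) + s A)))"

definition L1_norm :: "(real^'n) set \<Rightarrow> (real^'n \<Rightarrow> 'v::euclidean_space) \<Rightarrow> ereal" where
  "L1_norm \<Omega> f = enn2ereal (\<integral>\<^sup>+x. ennreal (norm (f x)) \<partial>lebesgue_on \<Omega>)"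

text \<open>\<^const>\<open>Least\<close> expresses a minimum: it is the value of the functional at a minimiser, and it
  is unspecified if there is none.\<close>

definition TGV2 :: "real \<Rightarrow> real \<Rightarrow> (real^'n) set \<Rightarrow> (real^'n \<Rightarrow> real) \<Rightarrow> ereal" where
  "TGV2 \<beta> \<alpha> \<Omega> u = (LEAST t. \<exists>w\<in>BD \<Omega>.
     t = ereal \<alpha> * radon_norm \<Omega> (\<lambda>v. dist_grad \<Omega> u v - fun_dist \<Omega> w v)
       + ereal \<beta> * radon_norm \<Omega> (sym_grad \<Omega> w))"

definition Ker_E :: "(real^'n \<Rightarrow> real^'n) set" where
  "Ker_E = {r. \<exists>A b. transpose A = - A \<and> r = (\<lambda>x. A *v x + b)}"

definition sobolev_korn_constant :: "(real^'n) set \<Rightarrow> real \<Rightarrow> bool" where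
  "sobolev_korn_constant \<Omega> C \<longleftrightarrow> C > 0 \<and>
     (\<forall>w\<in>BD \<Omega>. \<exists>r\<in>Ker_E. L1_norm \<Omega> (\<lambda>x. w x - r x) \<le> ereal C * radon_norm \<Omega> (sym_grad \<Omega> w))"

definition is_Ker_E_minimiser ::
    "(real^'n) set \<Rightarrow> (real^'n \<Rightarrow> real^'n) \<Rightarrow> (real^'n \<Rightarrow> real^'n) \<Rightarrow> bool" where
  "is_Ker_E_minimiser \<Omega> g m \<longleftrightarrow> m \<in> Ker_E \<and>
     (\<forall>w\<in>Ker_E. L1_norm \<Omega> (\<lambda>x. g x - m x) \<le> L1_norm \<Omega> (\<lambda>x. g x - w x))"

end

theory Submission
  imports Defs
begin

text \<open>If \<open>s\<close> is singular then \<open>\<parallel>h \<L>\<^sup>d + s\<parallel> = \<parallel>h\<parallel>\<^sub>1 + \<parallel>s\<parallel>\<close>: near a compact null set carrying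
  almost all of \<open>s\<close> a test function can be switched to any other one without affecting the integral
  against \<open>h\<close>. Applied to \<open>h = \<nabla>u - r\<close> and \<open>s = D\<^sup>su\<close> with \<open>r\<close> in the kernel of \<open>\<E>\<close>, this shows that
  the minimiser \<open>m\<close> of \<open>\<parallel>\<nabla>u - r\<parallel>\<^sub>1\<close> also minimises \<open>\<parallel>Du - r\<parallel>\<close> over the kernel. For arbitrary \<open>w\<close>,
  choosing \<open>r\<close> by the Sobolev--Korn inequality gives
  \<open>\<alpha> \<parallel>Du - m\<parallel> \<le> \<alpha> \<parallel>Du - r\<parallel> \<le> \<alpha> \<parallel>Du - w\<parallel> + \<alpha> C \<parallel>\<E>w\<parallel>\<close>, and \<open>\<alpha> C < \<beta>\<close>.\<close>


section \<open>Smooth functions\<close>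

text \<open>Two definitions dictate most of the length. \<open>ac_gradient\<close> is picked by
  \<open>SOME\<close>, so nothing is known about it until some Lebesgue decomposition of
  \<open>Du\<close> exists; as \<open>vector_measure\<close> is merely a countably additive set
  function, this rests on finiteness of the positive variation, the Jordan decomposition and a
  Radon-Nikodym density. \<open>radon_norm\<close> tests only against smooth functions with compact
  support in \<Omega>, so both the sign of a density and the switch near a null set must be
  approximated by such functions; hence the bumps, cutoffs and polynomials. The additivity of the
  norm enters only as a comparison: with a common singular part, the density of smaller L1 norm
  gives the smaller Radon norm (\<open>radon_norm_mono_density\<close>). This form needs neither the
  total variation of a vector measure nor extremal test functions. As \<open>TGV2\<close> is a
  \<open>LEAST\<close>, the claim amounts to a competitor attaining the value, namely
  \<open>m\<close> itself, and a lower bound for all competitors. Radon norms are extended reals, so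
  infinite values are separated before the constants are compared.\<close>

lemma partial_deriv_eq:
  "(f has_derivative f') (at x) \<Longrightarrow> partial_deriv j f x = f' (axis j 1)"
  by (metis frechet_derivative_at partial_deriv_def)

section \<open>Closure properties of the classes C^k\<close>

lemma Ck_SucD: "Ck (Suc k) f \<Longrightarrow> Ck k f"
proof (induction k arbitrary: f)
  case 0
  then show ?case
    by (auto intro!: continuous_at_imp_continuous_on differentiable_imp_continuous_within)
qed simp

lemma Ck_const: "Ck k (\<lambda>x. c)"
proof (induction k arbitrary: c)
  case (Suc k)
  have "partial_deriv j (\<lambda>x::real^'a. c) = (\<lambda>x. 0)" for j
    by (rule ext, subst partial_deriv_eq[OF has_derivative_const]) simp
  with Suc show ?case by simp
qed simp

lemma Ck_bounded_linear:
  assumes "bounded_linear f"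
  shows "Ck k f"
proof (cases k)
  case 0
  then show ?thesis using assms by (simp add: linear_continuous_on)
next
  case (Suc l)
  have d: "(f has_derivative f) (at x)" for x
    using assms by (rule bounded_linear_imp_has_derivative)
  have "partial_deriv j f = (\<lambda>x. f (axis j 1))" for j
    by (rule ext) (simp add: partial_deriv_eq[OF d])
  with d Suc show ?thesis by (auto simp: Ck_const differentiable_def)
qed

lemma Ck_add: "Ck k f \<Longrightarrow> Ck k g \<Longrightarrow> Ck k (\<lambda>x. f x + g x)"
proof (induction k arbitrary: f g)
  case (Suc k)
  have "partial_deriv j (\<lambda>x. f x + g x) = (\<lambda>x. partial_deriv j f x + partial_deriv j g x)" for j
  proof
    fix x
    obtain f' g' where d: "(f has_derivative f') (at x)" "(g has_derivative g') (at x)"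
      using Suc.prems by (meson Ck.simps(2) differentiable_def)
    show "partial_deriv j (\<lambda>x. f x + g x) x = partial_deriv j f x + partial_deriv j g x"
      by (simp add: partial_deriv_eq[OF has_derivative_add[OF d]] partial_deriv_eq[OF d(1)] partial_deriv_eq[OF d(2)])
  qed
  with Suc show ?case by simp
qed (simp add: continuous_on_add)

lemma partial_deriv_bilinear:
  assumes "bounded_bilinear pr" "f differentiable (at x)" "g differentiable (at x)"
  shows "partial_deriv j (\<lambda>x. pr (f x) (g x)) x = pr (f x) (partial_deriv j g x) + pr (partial_deriv j f x) (g x)"
proof -
  obtain f' g' where d: "(f has_derivative f') (at x)" "(g has_derivative g') (at x)"
    using assms by (meson differentiable_def)
  show ?thesis
    by (simp add: partial_deriv_eq[OF bounded_bilinear.FDERIV[OF assms(1) d]] partial_deriv_eq[OF d(1)] partial_deriv_eq[OF d(2)])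
qed

text \<open>One Leibniz argument serves scalar multiples, products and inner products. The
  derivative again contains an undifferentiated factor, so the step from \<open>k\<close> to
  \<open>Suc k\<close> also uses that both factors are \<open>Ck k\<close>.\<close>

lemma Ck_bilinear:
  assumes "bounded_bilinear pr"
  shows "Ck k f \<Longrightarrow> Ck k g \<Longrightarrow> Ck k (\<lambda>x. pr (f x) (g x))"
proof (induction k arbitrary: f g)
  case 0
  then show ?case using assms by (simp add: bounded_bilinear.continuous_on)
next
  case (Suc k)
  have d: "f differentiable (at x)" "g differentiable (at x)" for x
    using Suc.prems by auto
  then have "partial_deriv j (\<lambda>x. pr (f x) (g x)) = (\<lambda>x. pr (f x) (partial_deriv j g x) + pr (partial_deriv j f x) (g x))" for j
    using assms by (auto simp: partial_deriv_bilinear)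
  moreover have "Ck k (partial_deriv j f)" "Ck k (partial_deriv j g)" for j
    using Suc.prems by simp_all
  moreover have "Ck k f" "Ck k g" using Suc.prems by (blast intro: Ck_SucD)+
  moreover have "(\<lambda>x. pr (f x) (g x)) differentiable (at x)" for x
    using bounded_bilinear.FDERIV[OF assms d(1)[of x, unfolded frechet_derivative_works] d(2)[of x, unfolded frechet_derivative_works]]
    unfolding differentiable_def by blast
  ultimately show ?case by (simp add: Suc.IH Ck_add)
qed

lemmas Ck_scaleR = Ck_bilinear[OF bounded_bilinear_scaleR]
lemmas Ck_mult = Ck_bilinear[OF bounded_bilinear_mult]

lemma Ck_minus: "Ck k f \<Longrightarrow> Ck k (\<lambda>x. - f x)"
  using Ck_scaleR[of k "\<lambda>x. - 1" f] by (simp add: Ck_const)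

lemma Ck_diff: "Ck k f \<Longrightarrow> Ck k g \<Longrightarrow> Ck k (\<lambda>x. f x - g x)"
  using Ck_add[of k f "\<lambda>x. - g x"] by (simp add: Ck_minus)

lemma Ck_sum: "(\<And>i. i \<in> I \<Longrightarrow> Ck k (f i)) \<Longrightarrow> Ck k (\<lambda>x. \<Sum>i\<in>I. f i x)"
  by (induction I rule: infinite_finite_induct) (auto intro: Ck_const Ck_add)

lemma Ck_prod:
  fixes f :: "'i \<Rightarrow> real^'n \<Rightarrow> real"
  shows "(\<And>i. i \<in> I \<Longrightarrow> Ck k (f i)) \<Longrightarrow> Ck k (\<lambda>x. \<Prod>i\<in>I. f i x)"
  by (induction I rule: infinite_finite_induct) (auto intro: Ck_const Ck_mult)

lemma Ck_power:
  fixes f :: "real^'n \<Rightarrow> real"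
  shows "Ck k f \<Longrightarrow> Ck k (\<lambda>x. f x ^ m)"
  by (induction m) (auto intro: Ck_const Ck_mult)

lemma Ck_real_polynomial_function:
  fixes p :: "real^'n \<Rightarrow> real"
  assumes "real_polynomial_function p"
  shows "Ck k p"
  using assms by induction (auto intro: Ck_bounded_linear Ck_const Ck_add Ck_mult)

lemma Ck_polynomial_function:
  fixes p :: "real^'n \<Rightarrow> 'v::euclidean_space"
  assumes "polynomial_function p"
  shows "Ck k p"
proof -
  have "Ck k (\<lambda>x. \<Sum>b\<in>Basis. (p x \<bullet> b) *\<^sub>R b)"
    using assms by (intro Ck_sum Ck_scaleR Ck_const Ck_real_polynomial_function)
      (simp add: polynomial_function_iff_Basis_inner)
  then show ?thesis by (simp add: euclidean_representation)
qed

section \<open>Test functions, bumps and smooth cutoffs\<close>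

text \<open>Any compact set outside which \<open>v\<close> vanishes can stand in for the closure of
  the support, so supports never have to be computed.\<close>

lemma test_functionI:
  assumes "\<And>k. Ck k v" "{x. v x \<noteq> 0} \<subseteq> S" "compact S" "S \<subseteq> \<Omega>"
  shows "test_function \<Omega> v"
proof -
  have "closure {x. v x \<noteq> 0} \<subseteq> S"
    using assms compact_imp_closed closure_minimal by blast
  moreover have "bounded {x. v x \<noteq> 0}"
    using assms bounded_subset compact_imp_bounded by blast
  then have "compact (closure {x. v x \<noteq> 0})" by (simp add: compact_closure)
  ultimately show ?thesis
    using assms unfolding test_function_def by blast
qed

lemma test_functionE:
  assumes "test_function \<Omega> v"
  obtains S where "compact S" "S \<subseteq> \<Omega>" "\<And>x. x \<notin> S \<Longrightarrow> v x = 0" "\<And>k. Ck k v" "continuous_on UNIV v"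
proof -
  show thesis
  proof
    show "compact (closure {x. v x \<noteq> 0})" "closure {x. v x \<noteq> 0} \<subseteq> \<Omega>" and Ck: "Ck k v" for k
      using assms by (simp_all add: test_function_def)
    show "v x = 0" if "x \<notin> closure {x. v x \<noteq> 0}" for x
      using that closure_subset[of "{x. v x \<noteq> 0}"] by blast
    show "continuous_on UNIV v" using Ck[of 0] by simp
  qed
qed

text \<open>The coefficients are smooth functions without any condition on their support, because
  gluing uses a cutoff \<eta> together with 1 - \<eta>, and the latter has no compact support in
  general.\<close>

lemma test_function_combine:
  assumes "test_function \<Omega> v" "test_function \<Omega> w" "\<And>k. Ck k a" "\<And>k. Ck k b"
  shows "test_function \<Omega> (\<lambda>x. a x *\<^sub>R v x + b x *\<^sub>R w x)"
proof -
  obtain S where S: "compact S" "S \<subseteq> \<Omega>" "\<And>x. x \<notin> S \<Longrightarrow> v x = 0" "\<And>k. Ck k v" "continuous_on UNIV v"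
    by (rule test_functionE[OF assms(1)]) (rule that)
  obtain T where T: "compact T" "T \<subseteq> \<Omega>" "\<And>x. x \<notin> T \<Longrightarrow> w x = 0" "\<And>k. Ck k w" "continuous_on UNIV w"
    by (rule test_functionE[OF assms(2)]) (rule that)
  show ?thesis
  proof (rule test_functionI)
    show "Ck k (\<lambda>x. a x *\<^sub>R v x + b x *\<^sub>R w x)" for k
      by (intro Ck_add Ck_scaleR S T assms)
    show "{x. a x *\<^sub>R v x + b x *\<^sub>R w x \<noteq> 0} \<subseteq> S \<union> T"
      using S(3) T(3) by fastforce
    show "compact (S \<union> T)" "S \<union> T \<subseteq> \<Omega>"
      using S T by (auto intro: compact_Un)
  qed
qed

lemma test_function_0: "test_function \<Omega> (\<lambda>x. 0)"
  by (rule test_functionI[where S="{}"]) (simp_all add: Ck_const)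

text \<open>The functions \<open>t \<mapsto> t\<^bsup>-k\<^esup> exp (- 1 / t)\<close> on \<open>t > 0\<close>, extended by zero, span a space that is
  closed under differentiation.\<close>

definition flat :: "nat \<Rightarrow> real \<Rightarrow> real" where
  "flat k t = (if t \<le> 0 then 0 else inverse t ^ k * exp (- inverse t))"

text \<open>From the right, substituting s = 1/t turns the claim into s^k / exp s
  \<longlonglongrightarrow> 0 for s tending to infinity.\<close>

lemma flat_tendsto_0: "(flat k \<longlongrightarrow> 0) (at 0)"
proof -
  have "((\<lambda>t. inverse t ^ k / exp (inverse t)) \<longlongrightarrow> (0::real)) (at_right 0)"
    by (rule filterlim_compose[OF tendsto_power_div_exp_0 filterlim_inverse_at_top_right])
  moreover have "\<forall>\<^sub>F t in at_right 0. inverse t ^ k / exp (inverse t) = flat k t"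
    by (auto simp: flat_def eventually_at_filter exp_minus field_simps)
  ultimately have "(flat k \<longlongrightarrow> 0) (at_right 0)"
    using Lim_transform_eventually by blast
  moreover have "\<forall>\<^sub>F t in at_left 0. 0 = flat k t"
    by (auto simp: flat_def eventually_at_filter)
  then have "(flat k \<longlongrightarrow> 0) (at_left 0)"
    using Lim_transform_eventually tendsto_const by blast
  ultimately show ?thesis by (simp add: filterlim_split_at)
qed

lemma flat_has_derivative:
  "(flat k has_real_derivative flat (k + 2) t - k * flat (k + 1) t) (at t)"
proof -
  consider "t < 0" | "t = 0" | "t > 0" by linarith
  then show ?thesis
  proof cases
    case 1
    have "((\<lambda>t. 0) has_real_derivative 0) (at t)" by simp
    then have "(flat k has_real_derivative 0) (at t)"
      by (rule has_field_derivative_transform_within_open[where S="{..<0}"])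
        (use 1 in \<open>auto simp: flat_def\<close>)
    with 1 show ?thesis by (simp add: flat_def)
  next
    case 2
    have "\<forall>\<^sub>F h in at 0. flat (k + 1) h = flat k h / h"
      by (auto simp: flat_def eventually_at_filter field_simps)
    \<comment> \<open>The difference quotient of \<open>flat k\<close> at 0 is
      \<open>flat (k + 1)\<close>, whose limit there is already known.\<close>
    from Lim_transform_eventually[OF flat_tendsto_0 this]
    have "((\<lambda>h. flat k h / h) \<longlongrightarrow> 0) (at 0)" .
    with 2 show ?thesis by (simp add: DERIV_def flat_def)
  next
    case 3
    \<comment> \<open>The power rule yields the natural-number exponent \<open>k - 1\<close>, so
      small \<open>k\<close> are separated to avoid truncated subtraction.\<close>
    have "k = 0 \<or> k = 1 \<or> (\<exists>l. k = Suc (Suc l))" by presburger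
    then have "((\<lambda>t. inverse t ^ k * exp (- inverse t)) has_real_derivative
        inverse t ^ (k + 2) * exp (- inverse t) - k * (inverse t ^ (k + 1) * exp (- inverse t))) (at t)"
      by (elim disjE exE; use 3 in \<open>auto intro!: derivative_eq_intros simp: field_simps power2_eq_square\<close>; case_tac l; simp)
    then have "(flat k has_real_derivative inverse t ^ (k + 2) * exp (- inverse t) - k * (inverse t ^ (k + 1) * exp (- inverse t))) (at t)"
      by (rule has_field_derivative_transform_within_open[where S="{0<..}"])
        (use 3 in \<open>auto simp: flat_def\<close>)
    with 3 show ?thesis by (simp add: flat_def)
  qed
qed

text \<open>The induction keeps \<open>k\<close> general because differentiating
  \<open>flat k\<close> produces \<open>flat (k + 1)\<close> and \<open>flat (k + 2)\<close>;
  smoothness of \<rho> of every order is fixed once and for all.\<close>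

lemma Ck_flat:
  fixes \<rho> :: "real^'n \<Rightarrow> real"
  assumes \<rho>: "\<And>n. Ck n \<rho>"
  shows "Ck n (\<lambda>x. flat k (\<rho> x))"
proof (induction n arbitrary: k)
  case 0
  have "isCont (flat k) t" for t using flat_has_derivative DERIV_isCont by blast
  moreover have "continuous_on UNIV \<rho>" using \<rho>[of 0] by simp
  ultimately show ?case
    using continuous_on_compose2[of UNIV "flat k" UNIV \<rho>]
    by (auto simp: continuous_at_imp_continuous_on)
next
  case (Suc n)
  have \<rho>': "\<rho> differentiable (at x)" for x using \<rho>[of "Suc 0"] by simp
  have d: "((\<lambda>x. flat k (\<rho> x)) has_derivative
      (\<lambda>y. (flat (k + 2) (\<rho> x) - k * flat (k + 1) (\<rho> x)) * frechet_derivative \<rho> (at x) y)) (at x)" for x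
    using has_derivative_compose[OF frechet_derivative_works[THEN iffD1, OF \<rho>'[of x]]
      flat_has_derivative[of k "\<rho> x", unfolded has_field_derivative_def]]
    by simp
  have "partial_deriv j (\<lambda>x. flat k (\<rho> x)) =
      (\<lambda>x. (flat (k + 2) (\<rho> x) - k * flat (k + 1) (\<rho> x)) * partial_deriv j \<rho> x)" for j
    by (rule ext) (simp only: partial_deriv_eq[OF d], simp add: partial_deriv_def)
  moreover have "Ck n (partial_deriv j \<rho>)" for j using \<rho>[of "Suc n"] by simp
  ultimately have "Ck n (partial_deriv j (\<lambda>x. flat k (\<rho> x)))" for j
    by (simp only:) (intro Ck_mult Ck_diff Ck_const Suc)
  moreover have "(\<lambda>x. flat k (\<rho> x)) differentiable (at x)" for x
    using d[of x] unfolding differentiable_def by blast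
  ultimately show ?case by simp
qed

text \<open>The squared distance is a polynomial in \<open>x\<close>, so no smoothness is lost at
  the centre \<open>p\<close>.\<close>

definition bump :: "real^'n \<Rightarrow> real \<Rightarrow> real^'n \<Rightarrow> real" where
  "bump p r x = flat 0 (r\<^sup>2 - (x - p) \<bullet> (x - p))"

lemma Ck_bump: "Ck k (bump p r)"
  unfolding bump_def
  by (intro Ck_flat Ck_diff Ck_const Ck_bilinear[OF bounded_bilinear_inner] Ck_bounded_linear bounded_linear_ident)

lemma bump_bounds: "0 \<le> bump p r x" "bump p r x \<le> 1"
  by (auto simp: bump_def flat_def)

lemma bump_pos_iff: "r > 0 \<Longrightarrow> 0 < bump p r x \<longleftrightarrow> x \<in> ball p r"
proof -
  assume r: "r > 0"
  have "r\<^sup>2 - (x - p) \<bullet> (x - p) > 0 \<longleftrightarrow> (norm (x - p))\<^sup>2 < r\<^sup>2"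
    by (simp add: power2_norm_eq_inner)
  also have "\<dots> \<longleftrightarrow> norm (x - p) < r"
    using r by (meson norm_ge_zero power_less_imp_less_base power_strict_mono less_imp_le zero_less_numeral)
  finally have "r\<^sup>2 - (x - p) \<bullet> (x - p) > 0 \<longleftrightarrow> dist p x < r"
    by (simp add: dist_norm norm_minus_commute)
  then show ?thesis by (auto simp: bump_def flat_def not_le)
qed

text \<open>Asking only for \<open>1 - \<epsilon> \<le> \<eta>\<close> on \<open>K\<close> makes \<open>1 - (\<Prod>\<^sub>p 1 - bump\<^sub>p)\<^sup>m\<close> with large \<open>m\<close> suffice; no smooth
  step function is needed.\<close>

lemma smooth_cutoff:
  fixes K U :: "(real^'n) set"
  assumes "compact K" "open U" "K \<subseteq> U" "\<epsilon> > 0"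
  obtains \<eta> :: "real^'n \<Rightarrow> real"
  where "test_function U \<eta>" "\<And>x. 0 \<le> \<eta> x" "\<And>x. \<eta> x \<le> 1" "\<And>x. x \<in> K \<Longrightarrow> 1 - \<epsilon> \<le> \<eta> x"
proof -
  have "\<forall>p\<in>K. \<exists>r>0. cball p r \<subseteq> U"
    using assms(2,3) unfolding open_contains_cball by blast
  then obtain r where r: "\<And>p. p \<in> K \<Longrightarrow> r p > 0" "\<And>p. p \<in> K \<Longrightarrow> cball p (r p) \<subseteq> U" by metis
  have "K \<subseteq> (\<Union>p\<in>K. ball p (r p))" using r(1) by (meson UN_I centre_in_ball subsetI)
  then obtain F where F: "F \<subseteq> K" "finite F" "K \<subseteq> (\<Union>p\<in>F. ball p (r p))"
    by (rule compactE_image[OF assms(1) open_ball])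
  define \<Phi> where "\<Phi> x = (\<Prod>p\<in>F. 1 - bump p (r p) x)" for x
  have Ck\<Phi>: "Ck k \<Phi>" for k
    unfolding \<Phi>_def by (intro Ck_prod Ck_diff Ck_const Ck_bump)
  have \<Phi>: "0 \<le> \<Phi> x" "\<Phi> x \<le> 1" for x
    unfolding \<Phi>_def by (auto intro!: prod_nonneg prod_le_1 simp: bump_bounds)
  have \<Phi>K: "\<Phi> x < 1" if x: "x \<in> K" for x
  proof -
    obtain p where p: "p \<in> F" "x \<in> ball p (r p)" using x F by auto
    then have "bump p (r p) x > 0" using bump_pos_iff F(1) r(1) by blast
    moreover have "\<Phi> x = (1 - bump p (r p) x) * (\<Prod>p\<in>F - {p}. 1 - bump p (r p) x)"
      unfolding \<Phi>_def using p F by (simp add: prod.remove)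
    moreover have "(\<Prod>p\<in>F - {p}. 1 - bump p (r p) x) \<le> 1"
      by (auto intro!: prod_le_1 simp: bump_bounds)
    ultimately show ?thesis
      using bump_bounds(2)[of p "r p" x] mult_left_le[of "\<Prod>p\<in>F - {p}. 1 - bump p (r p) x" "1 - bump p (r p) x"]
      by linarith
  qed
  have "\<exists>m. \<forall>x\<in>K. \<Phi> x ^ m \<le> \<epsilon>"
  proof (cases "K = {}")
    case False
    \<comment> \<open>By compactness \<Phi> has a maximum on \<open>K\<close>, which is below 1, so
      a single power works for all points of \<open>K\<close>.\<close>
    have "continuous_on K \<Phi>"
      using Ck\<Phi>[of 0] by (auto intro: continuous_on_subset)
    then obtain x0 where x0: "x0 \<in> K" "\<And>x. x \<in> K \<Longrightarrow> \<Phi> x \<le> \<Phi> x0"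
      using continuous_attains_sup[OF assms(1) False] by blast
    obtain m where "\<Phi> x0 ^ m < \<epsilon>"
      using real_arch_pow_inv[OF assms(4) \<Phi>K[OF x0(1)]] by blast
    then show ?thesis
      using x0(2) \<Phi>(1) by (intro exI[of _ m]) (meson less_imp_le order_trans power_mono)
  qed auto
  then obtain m where m: "\<And>x. x \<in> K \<Longrightarrow> \<Phi> x ^ m \<le> \<epsilon>" by blast
  define \<eta> where "\<eta> x = 1 - \<Phi> x ^ m" for x
  show thesis
  proof
    show "test_function U \<eta>"
    proof (rule test_functionI)
      show "Ck k \<eta>" for k
        unfolding \<eta>_def by (intro Ck_diff Ck_power Ck_const Ck\<Phi>)
      show "compact (\<Union>p\<in>F. cball p (r p))" using F by (intro compact_UN) auto
      show "(\<Union>p\<in>F. cball p (r p)) \<subseteq> U" using F(1) r(2) by blast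
      show "{x. \<eta> x \<noteq> 0} \<subseteq> (\<Union>p\<in>F. cball p (r p))"
      proof
        fix x assume "x \<in> {x. \<eta> x \<noteq> 0}"
        then have "\<Phi> x \<noteq> 1" by (auto simp: \<eta>_def)
        then obtain p where p: "p \<in> F" "bump p (r p) x \<noteq> 0" unfolding \<Phi>_def
          by (metis (no_types, lifting) diff_zero prod.neutral)
        then have "x \<in> ball p (r p)" using bump_bounds(1)[of p "r p" x] F(1) r(1)[of p] bump_pos_iff[of "r p" p x] by (metis less_eq_real_def subsetD)
        then have "x \<in> cball p (r p)" by simp
        with p show "x \<in> (\<Union>p\<in>F. cball p (r p))" by blast
      qed
    qed
    show "0 \<le> \<eta> x" "\<eta> x \<le> 1" for x
      unfolding \<eta>_def using \<Phi>[of x] by (auto simp: power_le_one)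
    show "1 - \<epsilon> \<le> \<eta> x" if "x \<in> K" for x
      unfolding \<eta>_def using m[OF that] by simp
  qed
qed


section \<open>Signed measures\<close>

lemma vector_measureD:
  assumes "vector_measure \<Omega> m" "range A \<subseteq> borel_subsets \<Omega>" "disjoint_family A"
  shows "(\<lambda>k. m (A k)) sums m (\<Union>k. A k)"
  using assms unfolding vector_measure_def by blast

lemma vector_measure_bounded_linear:
  assumes "vector_measure \<Omega> m" "bounded_linear f"
  shows "vector_measure \<Omega> (\<lambda>A. f (m A))"
  using assms(1) bounded_linear.sums[OF assms(2)] unfolding vector_measure_def by blast

lemma vector_measure_inner: "vector_measure \<Omega> m \<Longrightarrow> vector_measure \<Omega> (\<lambda>A. m A \<bullet> b)"
  by (erule vector_measure_bounded_linear[OF _ bounded_linear_inner_left])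

lemma vector_measure_uminus: "vector_measure \<Omega> m \<Longrightarrow> vector_measure \<Omega> (\<lambda>A. - m A)"
  by (erule vector_measure_bounded_linear) (simp add: bounded_linear_minus bounded_linear_ident)

text \<open>Empty sets form a disjoint family, so the series with all terms equal to
  \<open>m {}\<close> converges, and a constant sequence of terms tending to 0 must vanish.\<close>

lemma vector_measure_empty:
  assumes "vector_measure \<Omega> m"
  shows "m {} = 0"
proof -
  have "(\<lambda>k::nat. m {}) sums m (\<Union>k::nat. {})"
    by (rule vector_measureD[OF assms]) (auto simp: disjoint_family_on_def)
  then have "(\<lambda>k::nat. m {}) \<longlonglongrightarrow> 0"
    by (intro summable_LIMSEQ_zero) (rule sums_summable)
  then show ?thesis by (simp add: LIMSEQ_const_iff)
qed

lemma vector_measure_Un: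
  assumes "vector_measure \<Omega> m" "A \<in> borel_subsets \<Omega>" "B \<in> borel_subsets \<Omega>" "A \<inter> B = {}"
  shows "m (A \<union> B) = m A + m B"
proof -
  have "(\<lambda>k. m (binaryset A B k)) sums m (\<Union>k. binaryset A B k)"
    using assms by (intro vector_measureD) (auto simp: range_binaryset_eq disjoint_family_on_def binaryset_def)
  moreover have "(\<lambda>k. m (binaryset A B k)) sums (m A + m B)"
    by (rule binaryset_sums) (rule vector_measure_empty[OF assms(1)])
  ultimately show ?thesis by (simp add: UN_binaryset_eq sums_unique2)
qed

lemma vector_measure_Diff:
  assumes "vector_measure \<Omega> m" "A \<in> borel_subsets \<Omega>" "B \<in> borel_subsets \<Omega>" "B \<subseteq> A"
  shows "m (A - B) = m A - m B"
proof -
  have "m ((A - B) \<union> B) = m (A - B) + m B"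
    using assms by (intro vector_measure_Un) auto
  moreover have "(A - B) \<union> B = A" using assms by blast
  ultimately show ?thesis by simp
qed

text \<open>\<open>E 0\<close> minus the intersection is the disjoint union of the layers
  \<open>E n - E (Suc n)\<close>, and the measures of the layers telescope.\<close>

lemma vector_measure_decseq:
  assumes m: "vector_measure \<Omega> m" and E: "\<And>n. E n \<in> borel_subsets \<Omega>" "decseq E"
  shows "(\<lambda>n. m (E n)) \<longlonglongrightarrow> m (\<Inter>n. E n)"
proof -
  have sub: "E (Suc n) \<subseteq> E n" for n using E(2) by (simp add: decseq_Suc_iff)
  have mono: "E j \<subseteq> E i" if "i \<le> j" for i j using E(2) that by (auto simp: decseq_def)
  define D where "D n = E n - E (Suc n)" for n
  have D: "D n \<in> borel_subsets \<Omega>" for n unfolding D_def using E(1) by (intro sets.Diff)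
  have I: "(\<Inter>n. E n) \<in> borel_subsets \<Omega>" using E(1) by (intro sets.countable_INT) auto
  have "(\<Union>n. D n) = E 0 - (\<Inter>n. E n)"
  proof (intro equalityI subsetI)
    fix x assume "x \<in> (\<Union>n. D n)"
    then show "x \<in> E 0 - (\<Inter>n. E n)" using mono[of 0] by (auto simp: D_def)
  next
    fix x assume x: "x \<in> E 0 - (\<Inter>n. E n)"
    then have ex: "\<exists>n. x \<notin> E n" by blast
    \<comment> \<open>The first index at which \<open>x\<close> has left the sequence;
      \<open>x\<close> lies in the layer just before it.\<close>
    define n where "n = (LEAST n. x \<notin> E n)"
    have n: "x \<notin> E n" unfolding n_def using ex by (rule LeastI_ex)
    moreover have "n \<noteq> 0" using n x by (metis DiffD1)
    then obtain k where k: "n = Suc k" using not0_implies_Suc by blast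
    have "x \<in> E k" using not_less_Least[of k "\<lambda>n. x \<notin> E n"] k n_def by auto
    ultimately show "x \<in> (\<Union>n. D n)" using k unfolding D_def by blast
  qed
  moreover have "disjoint_family D"
  proof -
    have "D i \<inter> D j = {}" if "i < j" for i j
      using mono[of "Suc i" j] that unfolding D_def by auto
    then show ?thesis unfolding disjoint_family_on_def by (metis inf_commute linorder_neqE_nat)
  qed
  ultimately have "(\<lambda>n. m (D n)) sums m (E 0 - (\<Inter>n. E n))"
    using vector_measureD[OF m, of D] D by (auto simp: image_subset_iff)
  moreover have "m (E 0 - (\<Inter>n. E n)) = m (E 0) - m (\<Inter>n. E n)"
    by (rule vector_measure_Diff[OF m E(1) I]) blast
  moreover have "(\<Sum>k<n. m (D k)) = m (E 0) - m (E n)" for n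
  proof (induction n)
    case (Suc n)
    have "m (D n) = m (E n) - m (E (Suc n))"
      unfolding D_def by (rule vector_measure_Diff[OF m E(1) E(1) sub])
    with Suc show ?case by simp
  qed simp
  ultimately have "(\<lambda>n. m (E 0) - m (E n)) \<longlonglongrightarrow> m (E 0) - m (\<Inter>n. E n)"
    by (simp add: sums_def)
  then have "(\<lambda>n. m (E 0) - (m (E 0) - m (E n))) \<longlonglongrightarrow> m (E 0) - (m (E 0) - m (\<Inter>n. E n))"
    by (rule tendsto_diff[OF tendsto_const])
  then show ?thesis by (simp only: diff_diff_eq2 add_diff_cancel_left')
qed

section \<open>Positive variation and Jordan decomposition\<close>

text \<open>This is the set function inside \<open>positive_part\<close>, named so that it can be
  studied before it is known to be a measure. As \<open>ennreal\<close> sends negative reals to 0,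
  it is the supremum of the positive parts of the values on Borel subsets; the value infinity is
  excluded only later.\<close>

definition pos_variation :: "(real^'n) set \<Rightarrow> ((real^'n) set \<Rightarrow> real) \<Rightarrow> (real^'n) set \<Rightarrow> ennreal" where
  "pos_variation \<Omega> \<mu> A = (SUP B\<in>{B\<in>borel_subsets \<Omega>. B \<subseteq> A}. ennreal (\<mu> B))"

lemma le_pos_variation: "B \<in> borel_subsets \<Omega> \<Longrightarrow> B \<subseteq> A \<Longrightarrow> ennreal (\<mu> B) \<le> pos_variation \<Omega> \<mu> A"
  unfolding pos_variation_def by (rule SUP_upper) simp

lemma pos_variation_mono: "A \<subseteq> B \<Longrightarrow> pos_variation \<Omega> \<mu> A \<le> pos_variation \<Omega> \<mu> B"
  unfolding pos_variation_def by (rule SUP_subset_mono) auto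

text \<open>Only an inequality can hold: truncation of negative terms at 0 makes
  \<open>ennreal\<close> subadditive on the reals. It passes from finite sums to the limit.\<close>

lemma ennreal_le_suminf_ennreal:
  fixes f :: "nat \<Rightarrow> real"
  assumes "f sums s"
  shows "ennreal s \<le> (\<Sum>k. ennreal (f k))"
proof (rule LIMSEQ_le_const2)
  show "(\<lambda>n. ennreal (\<Sum>k<n. f k)) \<longlonglongrightarrow> ennreal s"
    using assms unfolding sums_def by (rule tendsto_ennrealI)
  have "ennreal (\<Sum>k<n. f k) \<le> (\<Sum>k<n. ennreal (f k))" for n
  proof (induction n)
    case (Suc n)
    have "ennreal (a + b) \<le> ennreal a + ennreal b" for a b :: real
      by (cases "a \<ge> 0"; cases "b \<ge> 0") (auto simp: ennreal_plus[symmetric] ennreal_neg intro!: ennreal_leI simp del: ennreal_plus)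
    from this[of "\<Sum>k<n. f k" "f n"] Suc show ?case
      by simp (meson add_mono order_refl order_trans)
  qed simp
  also have "\<And>n. (\<Sum>k<n. ennreal (f k)) \<le> (\<Sum>k. ennreal (f k))"
    by (intro sum_le_suminf) auto
  finally show "\<exists>N. \<forall>n\<ge>N. ennreal (\<Sum>k<n. f k) \<le> (\<Sum>k. ennreal (f k))" by blast
qed

text \<open>Competitors \<open>C\<close> for \<open>A\<close> and \<open>D\<close> for
  \<open>B\<close> combine to the competitor \<open>C \<union> D\<close>. If one of them has
  negative value, it counts as 0 after truncation and the other one alone competes.\<close>

lemma pos_variation_superadd:
  assumes \<mu>: "vector_measure \<Omega> \<mu>" and "A \<inter> B = {}"
  shows "pos_variation \<Omega> \<mu> A + pos_variation \<Omega> \<mu> B \<le> pos_variation \<Omega> \<mu> (A \<union> B)"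
proof -
  let ?S = "\<lambda>A. {B\<in>borel_subsets \<Omega>. B \<subseteq> A}"
  have ne: "?S A \<noteq> {}" for A by auto
  have le: "ennreal (\<mu> C) + ennreal (\<mu> D) \<le> pos_variation \<Omega> \<mu> (A \<union> B)" if C: "C \<in> ?S A" and D: "D \<in> ?S B" for C D
  proof -
    consider "\<mu> C < 0" | "\<mu> D < 0" | "\<mu> C \<ge> 0" "\<mu> D \<ge> 0" by linarith
    then show ?thesis
    proof cases
      case 1
      with D le_pos_variation[of D \<Omega> "A \<union> B" \<mu>] show ?thesis by (simp add: ennreal_neg le_supI2)
    next
      case 2
      with C le_pos_variation[of C \<Omega> "A \<union> B" \<mu>] show ?thesis by (simp add: ennreal_neg le_supI1)
    next
      case 3
      have "\<mu> (C \<union> D) = \<mu> C + \<mu> D"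
        using C D assms by (intro vector_measure_Un[OF \<mu>]) auto
      then have "ennreal (\<mu> C) + ennreal (\<mu> D) = ennreal (\<mu> (C \<union> D))" using 3 by simp
      also have "\<dots> \<le> pos_variation \<Omega> \<mu> (A \<union> B)" using C D by (intro le_pos_variation) auto
      finally show ?thesis .
    qed
  qed
  have "pos_variation \<Omega> \<mu> A + pos_variation \<Omega> \<mu> B =
      (SUP C\<in>?S A. ennreal (\<mu> C) + pos_variation \<Omega> \<mu> B)"
    unfolding pos_variation_def[of \<Omega> \<mu> A] by (rule ennreal_SUP_add_left[symmetric, OF ne])
  also have "\<dots> \<le> pos_variation \<Omega> \<mu> (A \<union> B)"
  proof (rule SUP_least)
    fix C assume C: "C \<in> ?S A"
    have "ennreal (\<mu> C) + pos_variation \<Omega> \<mu> B = (SUP D\<in>?S B. ennreal (\<mu> C) + ennreal (\<mu> D))"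
      unfolding pos_variation_def[of \<Omega> \<mu> B] by (rule ennreal_SUP_add_right[OF ne])
    also have "\<dots> \<le> pos_variation \<Omega> \<mu> (A \<union> B)" by (intro SUP_least le C)
    finally show "ennreal (\<mu> C) + pos_variation \<Omega> \<mu> B \<le> pos_variation \<Omega> \<mu> (A \<union> B)" .
  qed
  finally show ?thesis .
qed

text \<open>A competitor for the union is cut by the sets \<open>A k\<close> into competitors for
  the single suprema.\<close>

lemma pos_variation_subadd:
  assumes \<mu>: "vector_measure \<Omega> \<mu>" and A: "range A \<subseteq> borel_subsets \<Omega>" "disjoint_family A"
  shows "pos_variation \<Omega> \<mu> (\<Union>k. A k) \<le> (\<Sum>k. pos_variation \<Omega> \<mu> (A k))"
  unfolding pos_variation_def[of \<Omega> \<mu> "\<Union>k. A k"]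
proof (rule SUP_least)
  fix B assume "B \<in> {B\<in>borel_subsets \<Omega>. B \<subseteq> (\<Union>k. A k)}"
  then have B: "B \<in> borel_subsets \<Omega>" "B = (\<Union>k. B \<inter> A k)" by auto
  have BA: "B \<inter> A k \<in> borel_subsets \<Omega>" for k using B(1) A(1) by (intro sets.Int) auto
  have "(\<lambda>k. \<mu> (B \<inter> A k)) sums \<mu> (\<Union>k. B \<inter> A k)"
    using BA A(2) by (intro vector_measureD[OF \<mu>]) (auto simp: disjoint_family_on_def)
  then have "ennreal (\<mu> B) \<le> (\<Sum>k. ennreal (\<mu> (B \<inter> A k)))"
    using B(2) ennreal_le_suminf_ennreal by metis
  also have "\<dots> \<le> (\<Sum>k. pos_variation \<Omega> \<mu> (A k))"
    by (intro suminf_le le_pos_variation BA) auto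
  finally show "ennreal (\<mu> B) \<le> (\<Sum>k. pos_variation \<Omega> \<mu> (A k))" .
qed

lemma pos_variation_empty: "vector_measure \<Omega> \<mu> \<Longrightarrow> pos_variation \<Omega> \<mu> {} = 0"
proof -
  assume "vector_measure \<Omega> \<mu>"
  moreover have "{B\<in>borel_subsets \<Omega>. B \<subseteq> {}} = {{}}" by auto
  ultimately show ?thesis by (simp add: pos_variation_def vector_measure_empty)
qed

lemma countably_additive_pos_variation:
  assumes \<mu>: "vector_measure \<Omega> \<mu>"
  shows "countably_additive (borel_subsets \<Omega>) (pos_variation \<Omega> \<mu>)"
  unfolding countably_additive_def
proof (intro allI impI antisym)
  fix A :: "nat \<Rightarrow> (real^'a) set"
  assume A: "range A \<subseteq> borel_subsets \<Omega>" "disjoint_family A"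
  show "pos_variation \<Omega> \<mu> (\<Union>k. A k) \<le> (\<Sum>k. pos_variation \<Omega> \<mu> (A k))"
    by (rule pos_variation_subadd[OF \<mu> A])
  have "(\<Sum>k<n. pos_variation \<Omega> \<mu> (A k)) \<le> pos_variation \<Omega> \<mu> (\<Union>k<n. A k)" for n
  proof (induction n)
    case (Suc n)
    have "A k \<inter> A n = {}" if "k < n" for k
      using A(2) that by (simp add: disjoint_family_on_def)
    then have "(\<Union>k<n. A k) \<inter> A n = {}" by blast
    then have "pos_variation \<Omega> \<mu> (\<Union>k<n. A k) + pos_variation \<Omega> \<mu> (A n) \<le> pos_variation \<Omega> \<mu> ((\<Union>k<n. A k) \<union> A n)"
      by (rule pos_variation_superadd[OF \<mu>])
    moreover have "(\<Union>k<n. A k) \<union> A n = (\<Union>k<Suc n. A k)" by (auto simp: less_Suc_eq)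
    ultimately show ?case using Suc by simp (meson add_right_mono order_trans)
  qed simp
  also have "\<And>n. pos_variation \<Omega> \<mu> (\<Union>k<n. A k) \<le> pos_variation \<Omega> \<mu> (\<Union>k. A k)"
    by (rule pos_variation_mono) blast
  finally show "(\<Sum>k. pos_variation \<Omega> \<mu> (A k)) \<le> pos_variation \<Omega> \<mu> (\<Union>k. A k)"
    by (intro suminf_le_const) auto
qed

lemma sigma_algebra_borel_subsets: "sigma_algebra \<Omega> (borel_subsets \<Omega>)"
  using sets.sigma_algebra_axioms[of "restrict_space borel \<Omega>"] by (simp add: space_restrict_space)

lemma sets_positive_part: "sets (positive_part \<Omega> \<mu>) = borel_subsets \<Omega>"
  unfolding positive_part_def
  by (rule sigma_algebra.sets_measure_of_eq[OF sigma_algebra_borel_subsets])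

lemma space_positive_part: "space (positive_part \<Omega> \<mu>) = \<Omega>"
  using sets_eq_imp_space_eq[of "positive_part \<Omega> \<mu>" "restrict_space borel \<Omega>"]
  by (simp add: sets_positive_part space_restrict_space)

text \<open>\<open>measure_of\<close> falls back to the zero measure when its set function is not
  countably additive, so this equation is what gives \<open>positive_part\<close> its intended
  meaning.\<close>

lemma emeasure_positive_part:
  assumes "vector_measure \<Omega> \<mu>" "A \<in> borel_subsets \<Omega>"
  shows "emeasure (positive_part \<Omega> \<mu>) A = pos_variation \<Omega> \<mu> A"
  unfolding positive_part_def pos_variation_def[symmetric]
  by (rule emeasure_measure_of_sigma[OF sigma_algebra_borel_subsets _ countably_additive_pos_variation[OF assms(1)] assms(2)])
    (simp add: positive_def pos_variation_empty assms)

text \<open>If the positive variation were infinite, there would be a decreasing sequence of sets on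
  which \<open>\<bar>\<mu>\<bar>\<close> is unbounded, against continuity from above.\<close>

lemma pos_variation_finite:
  assumes \<mu>: "vector_measure \<Omega> \<mu>"
  shows "pos_variation \<Omega> \<mu> \<Omega> < \<infinity>"
proof (rule ccontr)
  let ?P = "\<lambda>n E. E \<in> borel_subsets \<Omega> \<and> pos_variation \<Omega> \<mu> E = \<infinity> \<and> (n \<noteq> 0 \<longrightarrow> real n \<le> \<bar>\<mu> E\<bar>)"
  assume "\<not> pos_variation \<Omega> \<mu> \<Omega> < \<infinity>"
  then have inf: "pos_variation \<Omega> \<mu> \<Omega> = \<infinity>" by (simp add: less_top[symmetric])
  have \<Omega>: "\<Omega> \<in> borel_subsets \<Omega>" by (metis sets.top space_positive_part sets_positive_part)
  have ex: "\<exists>E'. ?P (Suc n) E' \<and> E' \<subseteq> E" if E: "?P n E" for n E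
  proof -
    \<comment> \<open>The extra margin \<bar>\<mu> E\<bar> makes both \<bar>\<mu> B\<bar> and
      \<bar>\<mu> (E - B)\<bar> at least \<open>Suc n\<close>. By additivity one of the two sets has
      infinite variation, and either of them may be kept.\<close>
    have "ennreal (real (Suc n) + \<bar>\<mu> E\<bar>) < pos_variation \<Omega> \<mu> E" using E by simp
    then obtain B where B: "B \<in> borel_subsets \<Omega>" "B \<subseteq> E" "ennreal (real (Suc n) + \<bar>\<mu> E\<bar>) < ennreal (\<mu> B)"
      unfolding pos_variation_def less_SUP_iff by blast
    have ge: "real (Suc n) + \<bar>\<mu> E\<bar> < \<mu> B" using B(3) by (simp add: ennreal_less_iff del: of_nat_Suc ennreal_plus)
    have D: "E - B \<in> borel_subsets \<Omega>" "\<mu> (E - B) = \<mu> E - \<mu> B"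
      using E B by (auto intro: vector_measure_Diff[OF \<mu>])
    have "countably_additive (borel_subsets \<Omega>) (pos_variation \<Omega> \<mu>)" "positive (borel_subsets \<Omega>) (pos_variation \<Omega> \<mu>)"
      using countably_additive_pos_variation[OF \<mu>] by (auto simp: positive_def pos_variation_empty \<mu>)
    then have "additive (borel_subsets \<Omega>) (pos_variation \<Omega> \<mu>)"
      using sigma_algebra_borel_subsets by (meson ring_of_sets.countably_additive_additive algebra.axioms(1) sigma_algebra_def)
    then have "pos_variation \<Omega> \<mu> B + pos_variation \<Omega> \<mu> (E - B) = pos_variation \<Omega> \<mu> (B \<union> (E - B))"
      by (rule additiveD[symmetric]) (use B D in auto)
    moreover have "B \<union> (E - B) = E" using B by blast
    ultimately have "pos_variation \<Omega> \<mu> B = \<infinity> \<or> pos_variation \<Omega> \<mu> (E - B) = \<infinity>"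
      using E by (simp add: ennreal_add_eq_top)
    then show ?thesis
    proof
      assume "pos_variation \<Omega> \<mu> B = \<infinity>"
      with B ge show ?thesis by (intro exI[of _ B]) auto
    next
      assume "pos_variation \<Omega> \<mu> (E - B) = \<infinity>"
      with D ge show ?thesis by (intro exI[of _ "E - B"]) auto
    qed
  qed
  obtain E where E: "\<And>n. ?P n (E n)" "\<And>n. E (Suc n) \<subseteq> E n"
    using dependent_nat_choice[of ?P "\<lambda>n A B. B \<subseteq> A"] ex inf \<Omega> by metis
  have "(\<lambda>n. \<mu> (E n)) \<longlonglongrightarrow> \<mu> (\<Inter>n. E n)"
    using E by (intro vector_measure_decseq[OF \<mu>]) (auto simp: decseq_Suc_iff)
  then have "Bseq (\<lambda>n. \<mu> (E n))" by (intro convergent_imp_Bseq convergentI)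
  then obtain M where M: "\<And>n. norm (\<mu> (E n)) \<le> M" by (meson BseqE)
  obtain n where "real n > max M 0" using reals_Archimedean2 by blast
  with E(1)[of n] M[of n] show False by auto
qed

lemma finite_measure_positive_part:
  assumes "vector_measure \<Omega> \<mu>"
  shows "finite_measure (positive_part \<Omega> \<mu>)"
proof
  have "\<Omega> \<in> borel_subsets \<Omega>" by (metis sets.top space_positive_part sets_positive_part)
  then show "emeasure (positive_part \<Omega> \<mu>) (space (positive_part \<Omega> \<mu>)) \<noteq> \<infinity>"
    using pos_variation_finite[OF assms] by (simp add: space_positive_part emeasure_positive_part assms)
qed

text \<open>For Borel \<open>B \<subseteq> A\<close>, - \<mu> B = \<mu> (A - B) - \<mu> A, which is
  at most the positive variation of \<open>A\<close> minus \<mu> A. The supremum over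
  \<open>B\<close> gives one inequality; the other is the same statement for -\<mu>.\<close>

lemma Jordan_decomposition:
  assumes \<mu>: "vector_measure \<Omega> \<mu>" and A: "A \<in> borel_subsets \<Omega>"
  shows "\<mu> A = measure (positive_part \<Omega> \<mu>) A - measure (positive_part \<Omega> (\<lambda>A. - \<mu> A)) A"
proof -
  have *: "\<mu> A + measure (positive_part \<Omega> (\<lambda>A. - \<mu> A)) A \<le> measure (positive_part \<Omega> \<mu>) A"
    if \<mu>: "vector_measure \<Omega> \<mu>" for \<mu>
  proof -
    note \<mu>' = vector_measure_uminus[OF \<mu>]
    interpret P: finite_measure "positive_part \<Omega> \<mu>" by (rule finite_measure_positive_part[OF \<mu>])
    interpret N: finite_measure "positive_part \<Omega> (\<lambda>A. - \<mu> A)" by (rule finite_measure_positive_part[OF \<mu>'])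
    have eq: "ennreal (measure (positive_part \<Omega> \<mu>) A) = pos_variation \<Omega> \<mu> A"
      "ennreal (measure (positive_part \<Omega> (\<lambda>A. - \<mu> A)) A) = pos_variation \<Omega> (\<lambda>A. - \<mu> A) A"
      using emeasure_positive_part[OF \<mu> A] emeasure_positive_part[OF \<mu>' A]
        P.emeasure_eq_measure[of A] N.emeasure_eq_measure[of A] by simp_all
    have le: "\<mu> B \<le> measure (positive_part \<Omega> \<mu>) A" if "B \<in> borel_subsets \<Omega>" "B \<subseteq> A" for B
      using le_pos_variation[OF that, of \<mu>] unfolding eq(1)[symmetric] by (simp add: ennreal_le_iff)
    have "pos_variation \<Omega> (\<lambda>A. - \<mu> A) A \<le> ennreal (measure (positive_part \<Omega> \<mu>) A - \<mu> A)"
      unfolding pos_variation_def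
    proof (intro SUP_least ennreal_leI)
      fix B assume B: "B \<in> {B\<in>borel_subsets \<Omega>. B \<subseteq> A}"
      then have "\<mu> (A - B) \<le> measure (positive_part \<Omega> \<mu>) A" using A by (intro le) auto
      moreover have "\<mu> (A - B) = \<mu> A - \<mu> B"
        using B A by (intro vector_measure_Diff[OF \<mu>]) auto
      ultimately show "- \<mu> B \<le> measure (positive_part \<Omega> \<mu>) A - \<mu> A" by simp
    qed
    moreover have "\<mu> A \<le> measure (positive_part \<Omega> \<mu>) A" by (intro le A order_refl)
    ultimately show ?thesis
      unfolding eq(2)[symmetric] by (simp add: ennreal_le_iff)
  qed
  from *[OF \<mu>] *[OF vector_measure_uminus[OF \<mu>]] show ?thesis by simp
qed

section \<open>Integration against signed measures\<close>

text \<open>A class of integrands closed under sums and products: it holds the coordinates of test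
  functions as well as their cut-off versions by Borel sets, and it is integrable against every
  finite measure on \<Omega>.\<close>

definition bounded_borel :: "(real^'n) set \<Rightarrow> (real^'n \<Rightarrow> real) set" where
  "bounded_borel \<Omega> = {f \<in> borel_measurable (restrict_space borel \<Omega>). \<exists>B. \<forall>x\<in>\<Omega>. \<bar>f x\<bar> \<le> B}"

definition signed_integral :: "(real^'n) set \<Rightarrow> ((real^'n) set \<Rightarrow> real) \<Rightarrow> (real^'n \<Rightarrow> real) \<Rightarrow> real" where
  "signed_integral \<Omega> \<mu> f = (LINT x|positive_part \<Omega> \<mu>. f x) - (LINT x|positive_part \<Omega> (\<lambda>A. - \<mu> A). f x)"

lemma measure_integral_eq:
  "measure_integral \<Omega> m v = (\<Sum>b\<in>Basis. signed_integral \<Omega> (\<lambda>A. m A \<bullet> b) (\<lambda>x. v x \<bullet> b))"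
  by (simp add: measure_integral_def signed_integral_def)

lemma bounded_borelE:
  assumes "f \<in> bounded_borel \<Omega>"
  obtains B where "\<And>x. x \<in> \<Omega> \<Longrightarrow> \<bar>f x\<bar> \<le> B" "B \<ge> 0" "f \<in> borel_measurable (restrict_space borel \<Omega>)"
proof -
  from assms obtain B where "\<forall>x\<in>\<Omega>. \<bar>f x\<bar> \<le> B" "f \<in> borel_measurable (restrict_space borel \<Omega>)"
    unfolding bounded_borel_def by blast
  then show thesis by (intro that[of "max B 0"]) (auto simp: le_max_iff_disj)
qed

lemma bounded_borelI:
  "f \<in> borel_measurable (restrict_space borel \<Omega>) \<Longrightarrow> (\<And>x. x \<in> \<Omega> \<Longrightarrow> \<bar>f x\<bar> \<le> B) \<Longrightarrow> f \<in> bounded_borel \<Omega>"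
  unfolding bounded_borel_def by blast

lemma bounded_borel_add: "f \<in> bounded_borel \<Omega> \<Longrightarrow> g \<in> bounded_borel \<Omega> \<Longrightarrow> (\<lambda>x. f x + g x) \<in> bounded_borel \<Omega>"
proof (elim bounded_borelE)
  fix A B assume *: "\<And>x. x \<in> \<Omega> \<Longrightarrow> \<bar>f x\<bar> \<le> A" "\<And>x. x \<in> \<Omega> \<Longrightarrow> \<bar>g x\<bar> \<le> B"
   "f \<in> borel_measurable (restrict_space borel \<Omega>)" "g \<in> borel_measurable (restrict_space borel \<Omega>)"
  show ?thesis
  proof (rule bounded_borelI)
    show "\<bar>f x + g x\<bar> \<le> A + B" if "x \<in> \<Omega>" for x using *(1,2)[OF that] by linarith
  qed (use *(3,4) in measurable)
qed

lemma bounded_borel_mult: "f \<in> bounded_borel \<Omega> \<Longrightarrow> g \<in> bounded_borel \<Omega> \<Longrightarrow> (\<lambda>x. f x * g x) \<in> bounded_borel \<Omega>"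
proof (elim bounded_borelE)
  fix A B :: real assume *: "\<And>x. x \<in> \<Omega> \<Longrightarrow> \<bar>f x\<bar> \<le> A" "\<And>x. x \<in> \<Omega> \<Longrightarrow> \<bar>g x\<bar> \<le> B" "A \<ge> 0"
   "f \<in> borel_measurable (restrict_space borel \<Omega>)" "g \<in> borel_measurable (restrict_space borel \<Omega>)"
  show ?thesis
  proof (rule bounded_borelI)
    show "\<bar>f x * g x\<bar> \<le> A * B" if "x \<in> \<Omega>" for x
      using *(1,2)[OF that] by (simp add: abs_mult mult_mono')
  qed (use *(4,5) in measurable)
qed

lemma bounded_borel_const: "(\<lambda>x. c) \<in> bounded_borel \<Omega>"
  by (rule bounded_borelI[where B="\<bar>c\<bar>"]) auto

lemma borel_measurable_positive_part:
  "f \<in> borel_measurable (restrict_space borel \<Omega>) \<Longrightarrow> f \<in> borel_measurable (positive_part \<Omega> \<mu>)"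
  using measurable_cong_sets[of "restrict_space borel \<Omega>" "positive_part \<Omega> \<mu>"] sets_positive_part by blast

lemma integrable_positive_part:
  assumes "vector_measure \<Omega> \<mu>" "f \<in> bounded_borel \<Omega>"
  shows "integrable (positive_part \<Omega> \<mu>) f"
proof -
  interpret finite_measure "positive_part \<Omega> \<mu>" by (rule finite_measure_positive_part[OF assms(1)])
  obtain B where B: "\<And>x. x \<in> \<Omega> \<Longrightarrow> \<bar>f x\<bar> \<le> B" "f \<in> borel_measurable (restrict_space borel \<Omega>)"
    using assms(2) unfolding bounded_borel_def by blast
  show ?thesis
    by (rule integrable_const_bound[where B=B])
      (use B in \<open>auto intro!: AE_I2 simp: space_positive_part borel_measurable_positive_part\<close>)
qed

lemma signed_integral_add:
  assumes "vector_measure \<Omega> \<mu>" "f \<in> bounded_borel \<Omega>" "g \<in> bounded_borel \<Omega>"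
  shows "signed_integral \<Omega> \<mu> (\<lambda>x. f x + g x) = signed_integral \<Omega> \<mu> f + signed_integral \<Omega> \<mu> g"
  using assms unfolding signed_integral_def
  by (simp add: integrable_positive_part vector_measure_uminus)

lemma signed_integral_cmult: "signed_integral \<Omega> \<mu> (\<lambda>x. c * f x) = c * signed_integral \<Omega> \<mu> f"
  by (simp only: signed_integral_def integral_mult_right_zero right_diff_distrib)

lemma signed_integral_indicator:
  assumes "vector_measure \<Omega> \<mu>" "A \<in> borel_subsets \<Omega>"
  shows "signed_integral \<Omega> \<mu> (indicator A) = \<mu> A"
proof -
  have "A \<inter> \<Omega> = A" using assms(2) by (auto simp: sets_restrict_space)
  then show ?thesis
    by (simp add: signed_integral_def space_positive_part Jordan_decomposition[OF assms])
qed

lemma signed_integral_dominated_convergence: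
  assumes \<mu>: "vector_measure \<Omega> \<mu>"
    and "\<And>i. U i \<in> borel_measurable (restrict_space borel \<Omega>)" "f \<in> borel_measurable (restrict_space borel \<Omega>)"
    and "\<And>i x. x \<in> \<Omega> \<Longrightarrow> \<bar>U i x\<bar> \<le> B" "\<And>x. x \<in> \<Omega> \<Longrightarrow> (\<lambda>i. U i x) \<longlonglongrightarrow> f x"
  shows "(\<lambda>i. signed_integral \<Omega> \<mu> (U i)) \<longlonglongrightarrow> signed_integral \<Omega> \<mu> f"
proof -
  have *: "(\<lambda>i. LINT x|positive_part \<Omega> \<mu>. U i x) \<longlonglongrightarrow> (LINT x|positive_part \<Omega> \<mu>. f x)"
    if "vector_measure \<Omega> \<mu>" for \<mu>
    by (rule integral_dominated_convergence[where w="\<lambda>x. B"])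
      (use assms in \<open>auto intro!: AE_I2 borel_measurable_positive_part
        integrable_positive_part[OF that bounded_borel_const] simp: space_positive_part\<close>)
  show ?thesis
    unfolding signed_integral_def by (intro tendsto_diff * \<mu> vector_measure_uminus)
qed

lemma borel_measurable_lebesgue_on_if_restrict_borel:
  assumes "\<Omega> \<in> sets borel" "f \<in> borel_measurable (restrict_space borel \<Omega>)"
  shows "f \<in> borel_measurable (lebesgue_on \<Omega>)"
proof -
  have "sets (restrict_space borel \<Omega>) \<subseteq> sets (lebesgue_on \<Omega>)"
    using assms(1) by (auto simp: sets_restrict_space)
  with assms(2) show ?thesis
    by (auto simp: measurable_def space_restrict_space)
qed

lemma integrable_mult_bounded_borel:
  assumes "\<Omega> \<in> sets borel" "integrable (lebesgue_on \<Omega>) h" "f \<in> bounded_borel \<Omega>"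
  shows "integrable (lebesgue_on \<Omega>) (\<lambda>x. h x * f x :: real)"
proof -
  obtain B where B: "\<And>x. x \<in> \<Omega> \<Longrightarrow> \<bar>f x\<bar> \<le> B" "B \<ge> 0" "f \<in> borel_measurable (restrict_space borel \<Omega>)"
    using assms(3) by (elim bounded_borelE) (rule that)
  have [measurable]: "f \<in> borel_measurable (lebesgue_on \<Omega>)" "h \<in> borel_measurable (lebesgue_on \<Omega>)"
    using B(3) assms borel_measurable_lebesgue_on_if_restrict_borel by auto
  show ?thesis
  proof (rule Bochner_Integration.integrable_bound)
    show "integrable (lebesgue_on \<Omega>) (\<lambda>x. B * h x)" using assms(2) by simp
    show "AE x in lebesgue_on \<Omega>. norm (h x * f x) \<le> norm (B * h x)"
      using B(1,2) by (intro AE_I2) (simp add: abs_mult mult.commute[of B] mult_left_mono)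
  qed measurable
qed

lemma integrable_lebesgue_on_subset:
  fixes f :: "real^'n \<Rightarrow> 'v::euclidean_space"
  assumes "\<Omega> \<in> sets borel" "A \<in> borel_subsets \<Omega>" "integrable (lebesgue_on \<Omega>) f"
  shows "integrable (lebesgue_on A) f"
    and "(LINT x|lebesgue_on A. f x) = (LINT x|lebesgue_on \<Omega>. indicator A x *\<^sub>R f x)"
proof -
  have A: "A \<in> sets borel" "A \<subseteq> \<Omega>"
    using assms(1,2) by (auto simp: sets_restrict_space)
  then have eq: "lebesgue_on A = restrict_space (lebesgue_on \<Omega>) A"
    using assms(1) by (simp add: restrict_restrict_space Int_absorb1)
  have A': "A \<inter> space (lebesgue_on \<Omega>) \<in> sets (lebesgue_on \<Omega>)"
    using A assms(1) by (simp add: sets_restrict_space_iff Int_absorb2)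
  then show "integrable (lebesgue_on A) f"
    unfolding eq using A A' assms(3)
    by (subst integrable_restrict_space) (auto intro!: integrable_mult_indicator simp: Int_absorb2)
  show "(LINT x|lebesgue_on A. f x) = (LINT x|lebesgue_on \<Omega>. indicator A x *\<^sub>R f x)"
    unfolding eq by (rule integral_restrict_space[OF A'])
qed

text \<open>The hypothesis is the claim for indicators. Linearity and dominated convergence carry it
  to bounded nonnegative functions, and the splitting into positive and negative parts to all of
  \<open>bounded_borel\<close>.\<close>

lemma signed_integral_decompose:
  assumes \<Omega>: "\<Omega> \<in> sets borel" and \<mu>: "vector_measure \<Omega> \<mu>" and \<nu>: "vector_measure \<Omega> \<nu>"
    and h: "integrable (lebesgue_on \<Omega>) h"
    and eq: "\<And>A. A \<in> borel_subsets \<Omega> \<Longrightarrow> \<mu> A = (LINT x|lebesgue_on A. h x) + \<nu> A"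
    and f: "f \<in> bounded_borel \<Omega>"
  shows "signed_integral \<Omega> \<mu> f = (LINT x|lebesgue_on \<Omega>. h x * f x) + signed_integral \<Omega> \<nu> f"
proof -
  let ?Q = "\<lambda>f. signed_integral \<Omega> \<mu> f = (LINT x|lebesgue_on \<Omega>. h x * f x) + signed_integral \<Omega> \<nu> f"
  have Q_add: "?Q (\<lambda>x. f x + g x)" if "f \<in> bounded_borel \<Omega>" "g \<in> bounded_borel \<Omega>" "?Q f" "?Q g" for f g
    using that integrable_mult_bounded_borel[OF \<Omega> h]
    by (simp add: signed_integral_add \<mu> \<nu> distrib_left)
  have cmult: "?Q (\<lambda>x. c * f x)" if "?Q f" for f c
    using that by (simp add: signed_integral_cmult distrib_left mult.left_commute[of _ c])
  have nonneg: "?Q f" if f: "f \<in> borel_measurable (restrict_space borel \<Omega>)" "\<And>x. 0 \<le> f x"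
    and "\<And>x. x \<in> \<Omega> \<Longrightarrow> f x \<le> B" for f B
  proof -
    \<comment> \<open>The bound sits inside the induction statement, with \<open>B\<close> general:
      summands and approximants of a bounded nonnegative function inherit it, and it supplies the
      majorants for dominated convergence.\<close>
    have "(\<forall>x\<in>\<Omega>. f x \<le> B) \<longrightarrow> ?Q f" for B
      using f
    proof (induct arbitrary: B rule: borel_measurable_induct_real)
      case (set A)
      have "(LINT x|lebesgue_on A. h x) = (LINT x|lebesgue_on \<Omega>. h x * indicator A x)"
        using integrable_lebesgue_on_subset(2)[OF \<Omega> set h] by (simp add: mult.commute)
      with eq[OF set] show ?case by (simp add: signed_integral_indicator \<mu> \<nu> set)
    next
      case (mult f c)
      show ?case
      proof (cases "c = 0")
        case True
        then show ?thesis using cmult[of "\<lambda>x. 0" 0] by (simp add: signed_integral_def)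
      next
        case False
        then have "\<forall>x\<in>\<Omega>. f x \<le> B / c" if "\<forall>x\<in>\<Omega>. c * f x \<le> B"
          using that mult(1) by (simp add: field_simps)
        with mult cmult show ?thesis by blast
      qed
    next
      case (add f g)
      show ?case
      proof
        assume B: "\<forall>x\<in>\<Omega>. g x + f x \<le> B"
        have B': "g x \<le> B" "f x \<le> B" if "x \<in> \<Omega>" for x
          using B[rule_format, OF that] add(2)[of x] add(5)[of x] by linarith+
        then have "f \<in> bounded_borel \<Omega>" "g \<in> bounded_borel \<Omega>"
          using add by (auto intro!: bounded_borelI[where B=B])
        with B' add show "?Q (\<lambda>x. g x + f x)" using Q_add by blast
      qed
    next
      case (seq U)
      show ?case
      proof
        assume B: "\<forall>x\<in>\<Omega>. f x \<le> B"
        have lim: "(\<lambda>i. U i x) \<longlonglongrightarrow> f x" if "x \<in> \<Omega>" for x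
          using seq(5) that by (simp add: space_restrict_space)
        have le: "U i x \<le> B" if "x \<in> \<Omega>" for i x
        proof -
          have "U i x \<le> f x"
            using seq(4) lim[OF that] by (intro incseq_le) (auto simp: incseq_def le_fun_def)
          with B that show ?thesis by (meson order_trans)
        qed
        then have Q: "?Q (U i)" for i using seq(3)[of i B] by blast
        have ab: "\<bar>U i x\<bar> \<le> B" if "x \<in> \<Omega>" for i x using le[OF that, of i] seq(2)[of i x] by simp
        have f': "f \<in> borel_measurable (restrict_space borel \<Omega>)"
          by (rule borel_measurable_LIMSEQ_real[OF _ seq(1)]) (use lim in \<open>auto simp: space_restrict_space\<close>)
        have "(\<lambda>i. LINT x|lebesgue_on \<Omega>. h x * U i x) \<longlonglongrightarrow> (LINT x|lebesgue_on \<Omega>. h x * f x)"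
        proof (rule integral_dominated_convergence[where w="\<lambda>x. B * \<bar>h x\<bar>"])
          have [measurable]: "h \<in> borel_measurable (lebesgue_on \<Omega>)" "f \<in> borel_measurable (lebesgue_on \<Omega>)"
            "\<And>i. U i \<in> borel_measurable (lebesgue_on \<Omega>)"
            using f' seq(1) h borel_measurable_lebesgue_on_if_restrict_borel[OF \<Omega>] by auto
          show "(\<lambda>x. h x * f x) \<in> borel_measurable (lebesgue_on \<Omega>)"
            "\<And>i. (\<lambda>x. h x * U i x) \<in> borel_measurable (lebesgue_on \<Omega>)" by measurable
          show "integrable (lebesgue_on \<Omega>) (\<lambda>x. B * \<bar>h x\<bar>)" using h by simp
          show "AE x in lebesgue_on \<Omega>. (\<lambda>i. h x * U i x) \<longlonglongrightarrow> h x * f x"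
            using lim by (intro AE_I2 tendsto_mult tendsto_const) simp
          show "AE x in lebesgue_on \<Omega>. norm (h x * U i x) \<le> B * \<bar>h x\<bar>" for i
            using ab by (intro AE_I2) (simp add: abs_mult mult.commute[of B] mult_left_mono)
        qed
        moreover have "(\<lambda>i. signed_integral \<Omega> \<mu> (U i)) \<longlonglongrightarrow> signed_integral \<Omega> \<mu> f"
          by (rule signed_integral_dominated_convergence[OF \<mu> seq(1) f' ab]) (use lim in \<open>auto simp: space_restrict_space\<close>)
        moreover have "(\<lambda>i. signed_integral \<Omega> \<nu> (U i)) \<longlonglongrightarrow> signed_integral \<Omega> \<nu> f"
          by (rule signed_integral_dominated_convergence[OF \<nu> seq(1) f' ab]) (use lim in \<open>auto simp: space_restrict_space\<close>)
        ultimately show "?Q f"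
          unfolding Q using LIMSEQ_unique tendsto_add by blast
      qed
    qed
    with that show ?thesis by blast
  qed
  obtain B where B: "\<And>x. x \<in> \<Omega> \<Longrightarrow> \<bar>f x\<bar> \<le> B" "B \<ge> 0" "f \<in> borel_measurable (restrict_space borel \<Omega>)"
    using f by (elim bounded_borelE) (rule that)
  have p: "(\<lambda>x. max 0 (f x)) \<in> borel_measurable (restrict_space borel \<Omega>)"
    and n: "(\<lambda>x. max 0 (- f x)) \<in> borel_measurable (restrict_space borel \<Omega>)"
    using B(3) by measurable
  have parts: "max 0 (f x) + (-1) * max 0 (- f x) = f x" for x by (simp add: max_def)
  have "?Q (\<lambda>x. max 0 (f x) + (-1) * max 0 (- f x))"
  proof (intro Q_add cmult)
    show "(\<lambda>x. max 0 (f x)) \<in> bounded_borel \<Omega>" "(\<lambda>x. - 1 * max 0 (- f x)) \<in> bounded_borel \<Omega>"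
      using p n B(1) by (auto intro!: bounded_borelI[where B=B] simp: abs_le_iff B(2))
    show "?Q (\<lambda>x. max 0 (f x))" "?Q (\<lambda>x. max 0 (- f x))"
      using B(1,2) by (auto intro!: nonneg[where B=B] p n simp: abs_le_iff)
  qed
  then show ?thesis unfolding parts .
qed


section \<open>Lebesgue decomposition\<close>

lemma borel_subsetsD:
  assumes "\<Omega> \<in> sets borel" "A \<in> borel_subsets \<Omega>"
  shows "A \<in> sets borel" "A \<subseteq> \<Omega>"
  using assms by (auto simp: sets_restrict_space)

text \<open>A null set of maximal measure carries the singular part.\<close>

lemma finite_measure_maximal_null_set:
  assumes \<Omega>: "\<Omega> \<in> sets borel" and M: "finite_measure M" "sets M = borel_subsets \<Omega>"
  obtains Z where "Z \<in> borel_subsets \<Omega>" "emeasure lborel Z = 0"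
    "\<And>A. A \<in> borel_subsets \<Omega> \<Longrightarrow> emeasure lborel A = 0 \<Longrightarrow> A \<inter> Z = {} \<Longrightarrow> emeasure M A = 0"
proof -
  interpret finite_measure M by fact
  define \<N> where "\<N> = {Z \<in> borel_subsets \<Omega>. emeasure lborel Z = 0}"
  define c where "c = Sup (measure M ` \<N>)"
  have ne: "measure M ` \<N> \<noteq> {}" unfolding \<N>_def by (auto intro!: exI[of _ "{}"])
  have bdd: "bdd_above (measure M ` \<N>)"
    by (rule bdd_aboveI[where M="measure M (space M)"]) (auto intro: bounded_measure)
  have "\<exists>Z\<in>\<N>. c - 1 / real (Suc n) < measure M Z" for n
    using less_cSup_iff[OF ne bdd, of "c - 1 / real (Suc n)"] by (auto simp: c_def[symmetric])
  then obtain Z where Z: "\<And>n. Z n \<in> \<N>" "\<And>n. c - 1 / real (Suc n) < measure M (Z n)" by metis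
  have borel: "A \<in> sets borel" if "A \<in> borel_subsets \<Omega>" for A
    using borel_subsetsD(1)[OF \<Omega> that] .
  show thesis
  proof
    show U: "(\<Union>n. Z n) \<in> borel_subsets \<Omega>"
      using Z(1) unfolding \<N>_def by (intro sets.countable_UN) auto
    show U0: "emeasure lborel (\<Union>n. Z n) = 0"
      by (rule emeasure_UN_eq_0) (use Z(1) borel in \<open>auto simp: \<N>_def\<close>)
    fix A assume A: "A \<in> borel_subsets \<Omega>" "emeasure lborel A = 0" "A \<inter> (\<Union>n. Z n) = {}"
    \<comment> \<open>The union of the \<open>Z n\<close> already attains the supremum
      \<open>c\<close>. Adjoining \<open>A\<close> gives another null set, which would exceed
      \<open>c\<close> unless \<open>A\<close> has measure 0.\<close>
    have "emeasure lborel (A \<union> (\<Union>n. Z n)) = 0"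
      using A borel[OF A(1)] U0 borel[OF U] null_sets.Un[of A lborel "\<Union>n. Z n"] by (auto simp: null_sets_def)
    then have "A \<union> (\<Union>n. Z n) \<in> \<N>" unfolding \<N>_def using A U by auto
    then have "measure M (A \<union> (\<Union>n. Z n)) \<le> c"
      unfolding c_def by (intro cSup_upper bdd imageI)
    moreover have "measure M (A \<union> (\<Union>n. Z n)) = measure M A + measure M (\<Union>n. Z n)"
      using A U M(2) by (intro finite_measure_Union) auto
    moreover have "c - 1 / real (Suc n) \<le> measure M (\<Union>n. Z n)" for n
    proof -
      have "measure M (Z n) \<le> measure M (\<Union>n. Z n)"
        using U M(2) by (intro finite_measure_mono) auto
      with Z(2)[of n] show ?thesis by simp
    qed
    then have "c \<le> measure M (\<Union>n. Z n) + e" if "e > 0" for e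
      using nat_approx_posE[OF that] by (smt (verit))
    then have "c \<le> measure M (\<Union>n. Z n)" by (rule field_le_epsilon)
    ultimately have "measure M A = 0" using measure_nonneg[of M A] by linarith
    then show "emeasure M A = 0" by (simp add: emeasure_eq_measure)
  qed
qed

text \<open>Radon-Nikodym applies on the Borel sets, relative to the restriction of
  \<open>lborel\<close>; the resulting density is then carried over to the completed measure
  \<open>lebesgue_on \<Omega>\<close>.\<close>

lemma absolutely_continuous_density:
  assumes \<Omega>: "\<Omega> \<in> sets borel"
    and M: "finite_measure M" "sets M = borel_subsets \<Omega>"
    and ac: "\<And>A. A \<in> borel_subsets \<Omega> \<Longrightarrow> emeasure lborel A = 0 \<Longrightarrow> emeasure M A = 0"
  obtains h where "integrable (lebesgue_on \<Omega>) h"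
    "\<And>A. A \<in> borel_subsets \<Omega> \<Longrightarrow> measure M A = (LINT x|lebesgue_on A. h x)"
proof -
  interpret M: finite_measure M by fact
  let ?L = "restrict_space lborel \<Omega>"
  interpret L: sigma_finite_measure ?L
    using \<Omega> by (intro sigma_finite_measure_restrict_space sigma_finite_lborel) auto
  have sets: "sets ?L = borel_subsets \<Omega>" by (rule sets_restrict_space_cong) simp
  have sub: "A \<subseteq> \<Omega>" "A \<in> sets borel" if "A \<in> borel_subsets \<Omega>" for A
    using that \<Omega> by (auto simp: sets_restrict_space)
  have sp: "space M = \<Omega>"
    using sets_eq_imp_space_eq[OF M(2)] by (simp add: space_restrict_space)
  have "absolutely_continuous ?L M"
    unfolding absolutely_continuous_def
  proof
    fix A assume A: "A \<in> null_sets ?L"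
    then have A': "A \<in> borel_subsets \<Omega>" using sets by auto
    then have "emeasure lborel A = 0"
      using A \<Omega> sub[OF A'] by (simp add: null_sets_def emeasure_restrict_space)
    with ac[OF A'] A' M(2) show "A \<in> null_sets M" by auto
  qed
  then obtain f where f: "f \<in> borel_measurable ?L" "density ?L f = M"
    using L.Radon_Nikodym[of M] sets M(2) by auto
  \<comment> \<open>\<open>enn2real\<close> replaces infinity by 0, which is harmless because
    finiteness of \<open>M\<close> makes \<open>f\<close> finite almost everywhere.\<close>
  define h where "h x = enn2real (f x)" for x
  have h: "h \<in> borel_measurable ?L" unfolding h_def using f(1) by measurable
  have AE: "AE x in ?L. f x \<noteq> \<infinity>"
  proof (rule nn_integral_PInf_AE[OF f(1)])
    have "emeasure M \<Omega> = (\<integral>\<^sup>+x. f x * indicator \<Omega> x \<partial>?L)"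
      unfolding f(2)[symmetric] using f(1) \<Omega> by (intro emeasure_density) (auto simp: sets_restrict_space)
    also have "\<dots> = (\<integral>\<^sup>+x. f x \<partial>?L)"
      by (rule nn_integral_cong) (auto simp: space_restrict_space)
    finally show "(\<integral>\<^sup>+x. f x \<partial>?L) \<noteq> \<infinity>" using M.emeasure_finite by (metis infinity_ennreal_def)
  qed
  then have AE': "AE x in ?L. ennreal (h x) = f x"
    by eventually_elim (simp add: h_def ennreal_enn2real_if)
  have A_nn: "(\<integral>\<^sup>+x. ennreal (indicator A x * h x) \<partial>?L) = emeasure M A" if A: "A \<in> borel_subsets \<Omega>" for A
  proof -
    have "(\<integral>\<^sup>+x. ennreal (indicator A x * h x) \<partial>?L) = (\<integral>\<^sup>+x. f x * indicator A x \<partial>?L)"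
      by (rule nn_integral_cong_AE) (use AE' in \<open>eventually_elim, auto simp: indicator_def\<close>)
    also have "\<dots> = emeasure (density ?L f) A"
      using f(1) A sets by (intro emeasure_density[symmetric]) auto
    finally show ?thesis using f(2) by simp
  qed
  have A_meas: "(\<lambda>x. indicator A x * h x) \<in> borel_measurable ?L" if "A \<in> borel_subsets \<Omega>" for A
    using h that sets by measurable
  have A_LINT: "(LINT x|?L. indicator A x * h x) = measure M A" if A: "A \<in> borel_subsets \<Omega>" for A
    using integral_eq_nn_integral[OF A_meas[OF A]] A_nn[OF A] M.emeasure_eq_measure[of A]
    by (simp add: h_def)
  have int: "integrable ?L h"
  proof (rule integrableI_nonneg[OF h])
    have "(\<integral>\<^sup>+x. ennreal (h x) \<partial>?L) = (\<integral>\<^sup>+x. ennreal (indicator \<Omega> x * h x) \<partial>?L)"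
      by (rule nn_integral_cong) (auto simp: space_restrict_space)
    also have "\<dots> = emeasure M \<Omega>" using \<Omega> by (intro A_nn) (auto simp: sets_restrict_space)
    finally show "(\<integral>\<^sup>+x. ennreal (h x) \<partial>?L) < \<infinity>" using M.emeasure_finite by (simp add: less_top[symmetric])
  qed (auto simp: h_def)
  \<comment> \<open>Extension by zero gives a Borel function on the whole space, the form in which
    integrals against \<open>lborel\<close> and its completion can be compared.\<close>
  define k where "k x = indicator \<Omega> x *\<^sub>R h x" for x
  have hb: "k \<in> borel_measurable lborel"
    unfolding k_def
    using int \<Omega> by (subst (asm) integrable_restrict_space) auto
  have toL: "integrable (lebesgue_on \<Omega>) h"
    using int \<Omega> hb by (simp add: integrable_restrict_space integrable_completion flip: k_def)
  show thesis
  proof (rule that[OF toL])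
    fix A assume A: "A \<in> borel_subsets \<Omega>"
    have "(LINT x|lebesgue_on A. h x) = (LINT x|lebesgue. indicator A x *\<^sub>R h x)"
      using sub[OF A] by (intro integral_restrict_space) auto
    also have "\<dots> = (LINT x|lebesgue. indicator A x *\<^sub>R k x)"
      using sub[OF A] by (intro Bochner_Integration.integral_cong) (auto simp: indicator_def k_def)
    also have "\<dots> = (LINT x|lborel. indicator A x *\<^sub>R k x)"
      using sub[OF A] hb by (intro integral_completion borel_measurable_scaleR borel_measurable_indicator) auto
    also have "\<dots> = (LINT x|lborel. indicator \<Omega> x *\<^sub>R (indicator A x * h x))"
      by (simp add: k_def mult.left_commute)
    also have "\<dots> = (LINT x|?L. indicator A x * h x)"
      using \<Omega> by (intro integral_restrict_space[symmetric]) auto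
    finally show "measure M A = (LINT x|lebesgue_on A. h x)" using A_LINT[OF A] by simp
  qed
qed


lemma integral_inner_lebesgue_on:
  fixes g :: "real^'n \<Rightarrow> 'v::euclidean_space"
  assumes "\<Omega> \<in> sets borel" "A \<in> borel_subsets \<Omega>" "integrable (lebesgue_on \<Omega>) g"
  shows "(LINT x|lebesgue_on A. g x) \<bullet> b = (LINT x|lebesgue_on A. g x \<bullet> b)"
  using integrable_lebesgue_on_subset(1)[OF assms] by simp

lemma vector_measure_restrict:
  assumes "vector_measure \<Omega> m" "Z \<in> borel_subsets \<Omega>"
  shows "vector_measure \<Omega> (\<lambda>A. m (A \<inter> Z))"
  unfolding vector_measure_def
proof (intro allI impI)
  fix A :: "nat \<Rightarrow> (real^'a) set"
  assume A: "range A \<subseteq> borel_subsets \<Omega>" "disjoint_family A"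
  have "(\<lambda>k. m (A k \<inter> Z)) sums m (\<Union>k. A k \<inter> Z)"
    using A assms(2) by (intro vector_measureD[OF assms(1)]) (auto simp: disjoint_family_on_def)
  then show "(\<lambda>k. m (A k \<inter> Z)) sums m ((\<Union>k. A k) \<inter> Z)" by simp
qed

text \<open>Let \<open>Z\<close> unite the maximal null sets of the positive and negative parts of
  all coordinates. Away from \<open>Z\<close> each of these finite measures is absolutely continuous
  and has a density; the restriction of \<open>m\<close> to \<open>Z\<close> is the singular
  part.\<close>

lemma Lebesgue_decomposition:
  fixes m :: "(real^'n) set \<Rightarrow> 'v::euclidean_space"
  assumes \<Omega>: "\<Omega> \<in> sets borel" and m: "vector_measure \<Omega> m"
  obtains g s where "integrable (lebesgue_on \<Omega>) g" "vector_measure \<Omega> s" "lebesgue_singular \<Omega> s"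
    "\<And>A. A \<in> borel_subsets \<Omega> \<Longrightarrow> m A = (LINT x|lebesgue_on A. g x) + s A"
proof -
  \<comment> \<open>The pair \<open>p\<close> encodes a coordinate and a sign, so that all Jordan
    parts are handled as one finite family.\<close>
  define \<mu> where "\<mu> p = (\<lambda>A. if snd p then m A \<bullet> fst p else - (m A \<bullet> fst p))" for p :: "'v \<times> bool"
  have \<mu>: "vector_measure \<Omega> (\<mu> p)" for p
    unfolding \<mu>_def using vector_measure_inner[OF m] vector_measure_uminus[OF vector_measure_inner[OF m]]
    by (cases "snd p") simp_all
  let ?M = "\<lambda>p. positive_part \<Omega> (\<mu> p)"
  have fin: "finite_measure (?M p)" for p by (rule finite_measure_positive_part[OF \<mu>])
  have "\<exists>Z. Z \<in> borel_subsets \<Omega> \<and> emeasure lborel Z = 0 \<and>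
      (\<forall>A\<in>borel_subsets \<Omega>. emeasure lborel A = 0 \<longrightarrow> A \<inter> Z = {} \<longrightarrow> emeasure (?M p) A = 0)" for p
    by (rule finite_measure_maximal_null_set[OF \<Omega> fin[of p] sets_positive_part]) blast
  then obtain Zp where Zp: "\<And>p. Zp p \<in> borel_subsets \<Omega>" "\<And>p. emeasure lborel (Zp p) = 0"
    "\<And>p A. A \<in> borel_subsets \<Omega> \<Longrightarrow> emeasure lborel A = 0 \<Longrightarrow> A \<inter> Zp p = {} \<Longrightarrow> emeasure (?M p) A = 0"
    by metis
  define Z where "Z = (\<Union>p\<in>(Basis :: 'v set) \<times> UNIV. Zp p)"
  have Z: "Z \<in> borel_subsets \<Omega>"
    unfolding Z_def using Zp(1) by (intro sets.finite_UN) auto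
  have "Z \<in> null_sets lborel"
    unfolding Z_def using Zp(1,2) borel_subsetsD(1)[OF \<Omega>] by (intro null_sets.finite_UN) auto
  then have Z0: "emeasure lborel Z = 0" by auto
  have "\<exists>h. integrable (lebesgue_on \<Omega>) h \<and>
      (\<forall>A\<in>borel_subsets \<Omega>. measure (?M p) (A - Z) = (LINT x|lebesgue_on A. h x))" if p: "p \<in> Basis \<times> UNIV" for p
  proof -
    \<comment> \<open>An indicator density restricts the measure to the complement of
      \<open>Z\<close> while keeping space and measurable sets unchanged.\<close>
    let ?N = "density (?M p) (indicator (\<Omega> - Z))"
    have sub: "A \<subseteq> \<Omega>" if "A \<in> borel_subsets \<Omega>" for A using borel_subsetsD[OF \<Omega> that] by auto
    have \<Omega>Z: "\<Omega> - Z \<in> sets (?M p)"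
      using Z \<Omega> by (auto simp: sets_positive_part sets_restrict_space)
    have N: "emeasure ?N A = emeasure (?M p) (A - Z)" if "A \<in> borel_subsets \<Omega>" for A
    proof -
      have "(\<Omega> - Z) \<inter> A = A - Z" using sub[OF that] by blast
      then show ?thesis
        using that \<Omega>Z by (subst emeasure_restricted) (auto simp: sets_positive_part)
    qed
    have sp: "space ?N = \<Omega>" by (simp add: space_positive_part)
    have \<Omega>': "\<Omega> \<in> borel_subsets \<Omega>" using \<Omega> by (auto simp: sets_restrict_space)
    have finN: "finite_measure ?N"
      using finite_measure.emeasure_finite[OF fin] by (intro finite_measureI) (simp only: sp N[OF \<Omega>'] infinity_ennreal_def, blast)
    have acN: "emeasure ?N A = 0" if A: "A \<in> borel_subsets \<Omega>" "emeasure lborel A = 0" for A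
    proof -
      have "A - Z \<in> borel_subsets \<Omega>" using A Z by auto
      moreover have "emeasure lborel (A - Z) = 0"
        using emeasure_mono[of "A - Z" A lborel] A borel_subsetsD(1)[OF \<Omega> A(1)] by auto
      moreover have "(A - Z) \<inter> Zp p = {}" using p unfolding Z_def by blast
      ultimately show ?thesis using N[OF A(1)] Zp(3) by simp
    qed
    have setsN: "sets ?N = borel_subsets \<Omega>" by (simp add: sets_positive_part)
    show ?thesis
    proof (rule absolutely_continuous_density[OF \<Omega> finN setsN acN])
      fix h assume h: "integrable (lebesgue_on \<Omega>) h"
        "\<And>A. A \<in> borel_subsets \<Omega> \<Longrightarrow> measure ?N A = (LINT x|lebesgue_on A. h x)"
      then show ?thesis using N by (intro exI[of _ h]) (auto simp: measure_def)
    qed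
  qed
  then obtain h where h: "\<And>p. p \<in> Basis \<times> UNIV \<Longrightarrow> integrable (lebesgue_on \<Omega>) (h p)"
    "\<And>p A. p \<in> Basis \<times> UNIV \<Longrightarrow> A \<in> borel_subsets \<Omega> \<Longrightarrow> measure (?M p) (A - Z) = (LINT x|lebesgue_on A. h p x)"
    by metis
  define g where "g x = (\<Sum>b\<in>Basis. (h (b, True) x - h (b, False) x) *\<^sub>R b)" for x
  have g: "integrable (lebesgue_on \<Omega>) g"
    unfolding g_def using h(1) by (intro Bochner_Integration.integrable_sum integrable_scaleR_left Bochner_Integration.integrable_diff) auto
  have gb: "g x \<bullet> b = h (b, True) x - h (b, False) x" if "b \<in> Basis" for x b
    unfolding g_def using that by simp
  show thesis
  proof (rule that[OF g vector_measure_restrict[OF m Z]])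
    show "lebesgue_singular \<Omega> (\<lambda>A. m (A \<inter> Z))"
      unfolding lebesgue_singular_def using Z Z0 vector_measure_empty[OF m] by (intro bexI[of _ Z]) auto
    fix A assume A: "A \<in> borel_subsets \<Omega>"
    have AZ: "A - Z \<in> borel_subsets \<Omega>" using A Z by auto
    have "m (A - Z) = (LINT x|lebesgue_on A. g x)"
    proof (rule euclidean_eqI)
      fix b :: 'v assume b: "b \<in> Basis"
      have int: "integrable (lebesgue_on A) (h (b, c))" for c
        using b by (intro integrable_lebesgue_on_subset(1)[OF \<Omega> A] h(1)) auto
      have "m (A - Z) \<bullet> b = measure (?M (b, True)) (A - Z) - measure (?M (b, False)) (A - Z)"
        using Jordan_decomposition[OF vector_measure_inner[OF m] AZ, of b] by (simp add: \<mu>_def)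
      also have "\<dots> = (LINT x|lebesgue_on A. g x \<bullet> b)"
        using b int by (simp add: h(2)[OF _ A] gb)
      also have "\<dots> = (LINT x|lebesgue_on A. g x) \<bullet> b"
        by (rule integral_inner_lebesgue_on[OF \<Omega> A g, symmetric])
      finally show "m (A - Z) \<bullet> b = (LINT x|lebesgue_on A. g x) \<bullet> b" .
    qed
    moreover have "m ((A - Z) \<union> (A \<inter> Z)) = m (A - Z) + m (A \<inter> Z)"
      using A Z by (intro vector_measure_Un[OF m]) auto
    moreover have "(A - Z) \<union> (A \<inter> Z) = A" by blast
    ultimately show "m A = (LINT x|lebesgue_on A. g x) + m (A \<inter> Z)" by simp
  qed
qed

text \<open>The existence behind the \<open>SOME\<close> in \<open>ac_gradient\<close>: any measure
  representing \<open>Du\<close> has a Lebesgue decomposition, so the chosen version has the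
  defining property.\<close>

lemma ac_gradient:
  assumes "\<Omega> \<in> sets borel" "u \<in> BV \<Omega>"
  shows "integrable (lebesgue_on \<Omega>) (ac_gradient \<Omega> u) \<and>
     (\<exists>m s. represented_by \<Omega> (dist_grad \<Omega> u) m \<and> vector_measure \<Omega> s \<and> lebesgue_singular \<Omega> s \<and>
        (\<forall>A\<in>borel_subsets \<Omega>. m A = (LINT x|lebesgue_on A. ac_gradient \<Omega> u x) + s A))"
proof -
  obtain m where m: "represented_by \<Omega> (dist_grad \<Omega> u) m" using assms(2) unfolding BV_def by blast
  then have vm: "vector_measure \<Omega> m" unfolding represented_by_def by blast
  obtain g s where "integrable (lebesgue_on \<Omega>) g" "vector_measure \<Omega> s" "lebesgue_singular \<Omega> s"
    "\<And>A. A \<in> borel_subsets \<Omega> \<Longrightarrow> m A = (LINT x|lebesgue_on A. g x) + s A"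
    by (rule Lebesgue_decomposition[OF assms(1) vm]) (rule that)
  with m have ex: "\<exists>g. integrable (lebesgue_on \<Omega>) g \<and>
     (\<exists>m s. represented_by \<Omega> (dist_grad \<Omega> u) m \<and> vector_measure \<Omega> s \<and> lebesgue_singular \<Omega> s \<and>
        (\<forall>A\<in>borel_subsets \<Omega>. m A = (LINT x|lebesgue_on A. g x) + s A))"
    by (intro exI[of _ g] conjI exI[of _ m] exI[of _ s]) auto
  show ?thesis
    unfolding ac_gradient_def by (rule someI_ex[OF ex])
qed


section \<open>Duality for integrable functions\<close>

lemma test_function_bounded:
  assumes "test_function \<Omega> v"
  obtains B where "\<And>x. norm (v x) \<le> B" "B \<ge> 0"
proof -
  obtain S where S: "compact S" "S \<subseteq> \<Omega>" "\<And>x. x \<notin> S \<Longrightarrow> v x = 0" "\<And>k. Ck k v" "continuous_on UNIV v"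
    by (rule test_functionE[OF assms]) (rule that)
  have "compact (v ` S)" by (rule compact_continuous_image[OF continuous_on_subset[OF S(5)] S(1)]) simp
  then obtain B where B: "\<And>y. y \<in> v ` S \<Longrightarrow> norm y \<le> B"
    using compact_imp_bounded bounded_iff by metis
  show thesis
  proof (rule that[of "max B 0"])
    show "norm (v x) \<le> max B 0" for x
      using B[of "v x"] S(3)[of x] by (cases "x \<in> S") auto
  qed simp
qed

lemma continuous_borel_measurable_restrict:
  fixes f :: "real^'n \<Rightarrow> 'v::euclidean_space"
  shows "continuous_on UNIV f \<Longrightarrow> f \<in> borel_measurable (restrict_space borel \<Omega>)"
  by (intro measurable_restrict_space1 borel_measurable_continuous_onI)

lemma test_function_bounded_borel:
  assumes "test_function \<Omega> v"
  shows "(\<lambda>x. v x \<bullet> b) \<in> bounded_borel \<Omega>"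
proof -
  obtain B where B: "\<And>x. norm (v x) \<le> B" "B \<ge> 0" by (rule test_function_bounded[OF assms]) (rule that)
  have "continuous_on UNIV v" by (rule test_functionE[OF assms])
  then have "continuous_on UNIV (\<lambda>x. v x \<bullet> b)" by (intro continuous_intros)
  then show ?thesis
  proof (intro bounded_borelI continuous_borel_measurable_restrict)
    show "\<bar>v x \<bullet> b\<bar> \<le> B * norm b" for x
      using Cauchy_Schwarz_ineq2[of "v x" b] B(1)[of x] by (meson mult_right_mono norm_ge_zero order_trans)
  qed
qed

lemma integrable_inner_bounded:
  fixes h v :: "real^'n \<Rightarrow> 'v::euclidean_space"
  assumes "integrable (lebesgue_on \<Omega>) h" "v \<in> borel_measurable (lebesgue_on \<Omega>)" "\<And>x. x \<in> \<Omega> \<Longrightarrow> norm (v x) \<le> B"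
  shows "integrable (lebesgue_on \<Omega>) (\<lambda>x. h x \<bullet> v x)"
proof (rule Bochner_Integration.integrable_bound)
  have [measurable]: "h \<in> borel_measurable (lebesgue_on \<Omega>)" "v \<in> borel_measurable (lebesgue_on \<Omega>)" using assms by auto
  show "(\<lambda>x. h x \<bullet> v x) \<in> borel_measurable (lebesgue_on \<Omega>)" by measurable
  show "integrable (lebesgue_on \<Omega>) (\<lambda>x. B * norm (h x))" using assms(1) by simp
  show "AE x in lebesgue_on \<Omega>. norm (h x \<bullet> v x) \<le> norm (B * norm (h x))"
  proof (rule AE_I2)
    fix x assume "x \<in> space (lebesgue_on \<Omega>)"
    then have B: "norm (v x) \<le> B" using assms(3) by simp
    have "\<bar>h x \<bullet> v x\<bar> \<le> norm (h x) * norm (v x)" by (rule Cauchy_Schwarz_ineq2)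
    also have "\<dots> \<le> norm (h x) * B" using B by (rule mult_left_mono) simp
    finally show "norm (h x \<bullet> v x) \<le> norm (B * norm (h x))"
      by (simp add: abs_mult mult.commute) (metis abs_ge_self mult_right_mono norm_ge_zero order_trans mult.commute)
  qed
qed

lemma test_function_measurable:
  assumes "\<Omega> \<in> sets borel" "test_function \<Omega> v"
  shows "v \<in> borel_measurable (lebesgue_on \<Omega>)"
proof -
  have "continuous_on UNIV v" by (rule test_functionE[OF assms(2)])
  then show ?thesis
    using assms(1) by (intro continuous_imp_measurable_on_sets_lebesgue) (auto intro: continuous_on_subset)
qed

lemma integrable_inner_test_function:
  fixes h v :: "real^'n \<Rightarrow> 'v::euclidean_space"
  assumes "\<Omega> \<in> sets borel" "integrable (lebesgue_on \<Omega>) h" "test_function \<Omega> v"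
  shows "integrable (lebesgue_on \<Omega>) (\<lambda>x. h x \<bullet> v x)"
proof -
  obtain B where B: "\<And>x. norm (v x) \<le> B" "B \<ge> 0" by (rule test_function_bounded[OF assms(3)]) (rule that)
  show ?thesis by (rule integrable_inner_bounded[OF assms(2) test_function_measurable[OF assms(1,3)]]) (rule B(1))
qed

text \<open>Measurability gives continuous functions tending to \<open>sgn (h x)\<close> almost
  everywhere. Truncation to the unit ball keeps them bounded by 1, Stone-Weierstrass on the compact
  closure of \<Omega> replaces them by polynomials, hence smooth functions, and cutoffs supply
  compact support inside \<Omega>.\<close>

lemma test_functions_approximate_sgn:
  fixes h :: "real^'n \<Rightarrow> 'v::euclidean_space"
  assumes "open \<Omega>" "bounded \<Omega>" "h \<in> borel_measurable (lebesgue_on \<Omega>)"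
  obtains v where "\<And>n. test_function \<Omega> (v n)" "\<And>n x. norm (v n x) \<le> 1"
    "AE x in lebesgue_on \<Omega>. (\<lambda>n::nat. v n x) \<longlonglongrightarrow> sgn (h x)"
proof -
  have \<Omega>: "\<Omega> \<in> sets lebesgue" using assms(1) by auto
  \<comment> \<open>The radial retraction onto the closed unit ball. It fixes the values of
    \<open>sgn\<close>, so it does not change the limit.\<close>
  define T where "T y = y /\<^sub>R max 1 (norm y)" for y :: 'v
  have T1: "norm (T y) \<le> 1" for y unfolding T_def by (simp add: field_simps)
  have T_id: "T y = y" if "norm y \<le> 1" for y using that unfolding T_def by (simp add: max_def)
  have T_cont: "continuous_on UNIV T" unfolding T_def by (intro continuous_intros) auto
  have "(\<lambda>x. sgn (h x)) \<in> borel_measurable (lebesgue_on \<Omega>)"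
    using assms(3) unfolding sgn_div_norm by measurable
  then have "(\<lambda>x. sgn (h x)) measurable_on \<Omega>"
    using \<Omega> by (simp add: measurable_on_iff_borel_measurable)
  then obtain N g where N: "negligible N" and g: "\<And>n::nat. continuous_on UNIV (g n)"
    "\<And>x. x \<notin> N \<Longrightarrow> (\<lambda>n. g n x) \<longlonglongrightarrow> (if x \<in> \<Omega> then sgn (h x) else 0)"
    unfolding measurable_on_def by metis
  have "\<exists>p. polynomial_function p \<and> (\<forall>x\<in>closure \<Omega>. norm (T (g n x) - p x) < inverse (Suc n))" for n
    using assms(2) g(1)[of n] T_cont
    by (intro Stone_Weierstrass_polynomial_function continuous_on_compose2[OF T_cont])
      (auto intro: continuous_on_subset)
  then obtain p where p: "\<And>n. polynomial_function (p n)"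
    "\<And>n x. x \<in> closure \<Omega> \<Longrightarrow> norm (T (g n x) - p n x) < inverse (Suc n)" by metis
  \<comment> \<open>An exhaustion by compact sets: each point of \<Omega> eventually lies in
    \<open>C n\<close>, where the cutoff is close to 1.\<close>
  obtain C where C: "\<And>n::nat. compact (C n)" "\<And>n. C n \<subseteq> \<Omega>"
    "\<And>K. compact K \<Longrightarrow> K \<subseteq> \<Omega> \<Longrightarrow> \<exists>N. \<forall>n\<ge>N. K \<subseteq> C n"
    by (rule open_Union_compact_subsets[OF assms(1)]) (rule that)
  have "\<exists>\<eta>. test_function \<Omega> \<eta> \<and> (\<forall>x. 0 \<le> \<eta> x \<and> \<eta> x \<le> 1) \<and> (\<forall>x\<in>C n. 1 - inverse (Suc n) \<le> \<eta> x)" for n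
    by (rule smooth_cutoff[OF C(1)[of n] assms(1) C(2)[of n], of "inverse (Suc n)"]) auto
  then obtain \<eta> where \<eta>: "\<And>n. test_function \<Omega> (\<eta> n)" "\<And>n x. 0 \<le> \<eta> n x" "\<And>n x. \<eta> n x \<le> 1"
    "\<And>n x. x \<in> C n \<Longrightarrow> 1 - inverse (Suc n) \<le> \<eta> n x" by metis
  \<comment> \<open>On \<Omega> the polynomial \<open>p n\<close> has norm at most
    \<open>1 + inverse (Suc n)\<close>; this factor brings the bound back to 1 and tends to
    1.\<close>
  define c where "c n = inverse (1 + inverse (real (Suc n)))" for n
  define v where "v n x = (c n * \<eta> n x) *\<^sub>R p n x" for n x
  have tv: "test_function \<Omega> (v n)" for n
  proof -
    obtain S where S: "compact S" "S \<subseteq> \<Omega>" "\<And>x. x \<notin> S \<Longrightarrow> \<eta> n x = 0" "\<And>k. Ck k (\<eta> n)" "continuous_on UNIV (\<eta> n)"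
      by (rule test_functionE[OF \<eta>(1)]) (rule that)
    show ?thesis
    proof (rule test_functionI)
      show "Ck k (v n)" for k
        unfolding v_def by (intro Ck_scaleR Ck_mult Ck_const S Ck_polynomial_function p)
      show "{x. v n x \<noteq> 0} \<subseteq> S" using S(3) unfolding v_def by fastforce
    qed (use S in auto)
  qed
  have bound: "norm (v n x) \<le> 1" for n x
  proof (cases "x \<in> \<Omega>")
    case True
    then have "norm (T (g n x) - p n x) < inverse (Suc n)" using p(2) closure_subset by blast
    then have "norm (p n x) \<le> 1 + inverse (Suc n)"
      using T1[of "g n x"] norm_triangle_ineq3[of "p n x" "T (g n x)"] by (simp add: norm_minus_commute)
    then have cp: "c n * norm (p n x) \<le> 1" unfolding c_def by (simp add: field_simps add_pos_pos)
    have "norm (v n x) = \<eta> n x * (c n * norm (p n x))" using \<eta>(2) by (simp add: v_def c_def)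
    also have "\<dots> \<le> 1 * 1" using \<eta>(2,3) cp by (intro mult_mono) (auto simp: c_def)
    finally show ?thesis by simp
  next
    case False
    obtain S where "S \<subseteq> \<Omega>" "\<And>x. x \<notin> S \<Longrightarrow> \<eta> n x = 0"
      by (rule test_functionE[OF \<eta>(1)[of n]]) (rule that)
    with False have "\<eta> n x = 0" by blast
    then show ?thesis by (simp add: v_def)
  qed
  have lim: "(\<lambda>n. v n x) \<longlonglongrightarrow> sgn (h x)" if x: "x \<in> \<Omega>" "x \<notin> N" for x
  proof -
    have "(\<lambda>n. g n x) \<longlonglongrightarrow> sgn (h x)" using g(2)[OF x(2)] x(1) by simp
    moreover have "isCont T (sgn (h x))" using T_cont by (simp add: continuous_on_eq_continuous_at)
    ultimately have "(\<lambda>n. T (g n x)) \<longlonglongrightarrow> T (sgn (h x))" using isCont_tendsto_compose by blast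
    then have Tg: "(\<lambda>n. T (g n x)) \<longlonglongrightarrow> sgn (h x)" by (simp add: T_id norm_sgn)
    have "(\<lambda>n. T (g n x) - p n x) \<longlonglongrightarrow> 0"
    proof (rule Lim_null_comparison)
      show "\<forall>\<^sub>F n in sequentially. norm (T (g n x) - p n x) \<le> inverse (real (Suc n))"
        using p(2) x(1) closure_subset by (intro always_eventually allI less_imp_le) blast
    qed (rule LIMSEQ_inverse_real_of_nat)
    from tendsto_diff[OF Tg this] have px: "(\<lambda>n. p n x) \<longlonglongrightarrow> sgn (h x)" by simp
    have "c \<longlonglongrightarrow> inverse (1 + 0)"
      unfolding c_def by (intro tendsto_inverse tendsto_add tendsto_const LIMSEQ_inverse_real_of_nat) simp
    moreover have "(\<lambda>n. \<eta> n x) \<longlonglongrightarrow> 1"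
    proof (rule tendsto_sandwich)
      obtain n0 where "\<And>n. n \<ge> n0 \<Longrightarrow> {x} \<subseteq> C n" using C(3)[of "{x}"] x(1) by auto
      then show "\<forall>\<^sub>F n in sequentially. 1 - inverse (real (Suc n)) \<le> \<eta> n x"
        using \<eta>(4) by (intro eventually_sequentiallyI[of n0]) blast
      show "(\<lambda>n. 1 - inverse (real (Suc n))) \<longlonglongrightarrow> 1"
        using tendsto_diff[OF tendsto_const LIMSEQ_inverse_real_of_nat, of 1] by simp
    qed (auto simp: \<eta>(3))
    ultimately have "(\<lambda>n. v n x) \<longlonglongrightarrow> (inverse (1 + 0) * 1) *\<^sub>R sgn (h x)"
      unfolding v_def using px by (intro tendsto_scaleR tendsto_mult)
    then show ?thesis by simp
  qed
  have "AE x in lebesgue_on \<Omega>. (\<lambda>n. v n x) \<longlonglongrightarrow> sgn (h x)"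
  proof -
    have "AE x in lebesgue. x \<notin> N" using N by (simp add: AE_not_in negligible_iff_null_sets)
    then have "AE x in lebesgue. x \<in> \<Omega> \<longrightarrow> (\<lambda>n. v n x) \<longlonglongrightarrow> sgn (h x)"
      by eventually_elim (use lim in blast)
    then show ?thesis using \<Omega> by (subst AE_restrict_space_iff) auto
  qed
  with tv bound show thesis by (rule that)
qed

text \<open>The pairing of \<open>h x\<close> with \<open>sgn (h x)\<close> is
  \<open>norm (h x)\<close>. Along test functions tending to \<open>sgn (h x)\<close> the pairings
  converge by domination with \<open>norm (h x)\<close>, so some member of the sequence comes within
  \<open>e\<close>.\<close>

lemma L1_duality:
  fixes h :: "real^'n \<Rightarrow> 'v::euclidean_space"
  assumes "open \<Omega>" "bounded \<Omega>" "integrable (lebesgue_on \<Omega>) h" "e > 0"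
  obtains v where "test_function \<Omega> v" "\<And>x. norm (v x) \<le> 1"
    "(LINT x|lebesgue_on \<Omega>. norm (h x)) - e < (LINT x|lebesgue_on \<Omega>. h x \<bullet> v x)"
proof -
  have \<Omega>: "\<Omega> \<in> sets borel" using assms(1) by simp
  have h: "h \<in> borel_measurable (lebesgue_on \<Omega>)" using assms(3) by simp
  obtain v where v: "\<And>n. test_function \<Omega> (v n)" "\<And>n x. norm (v n x) \<le> 1"
    "AE x in lebesgue_on \<Omega>. (\<lambda>n::nat. v n x) \<longlonglongrightarrow> sgn (h x)"
    using test_functions_approximate_sgn[OF assms(1,2) h] by metis
  have hs: "h x \<bullet> sgn (h x) = norm (h x)" for x
    by (cases "h x = 0") (simp_all add: sgn_div_norm dot_square_norm power2_eq_square)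
  have "(\<lambda>n. LINT x|lebesgue_on \<Omega>. h x \<bullet> v n x) \<longlonglongrightarrow> (LINT x|lebesgue_on \<Omega>. norm (h x))"
  proof (rule integral_dominated_convergence[where w="\<lambda>x. norm (h x)"])
    show "AE x in lebesgue_on \<Omega>. (\<lambda>n. h x \<bullet> v n x) \<longlonglongrightarrow> norm (h x)"
      using v(3)
    proof eventually_elim
      case (elim x)
      from tendsto_inner[OF tendsto_const this, of "h x"] show ?case by (simp add: hs)
    qed
    show "AE x in lebesgue_on \<Omega>. norm (h x \<bullet> v n x) \<le> norm (h x)" for n
    proof (rule AE_I2)
      fix x
      have "norm (h x \<bullet> v n x) \<le> norm (h x) * norm (v n x)" using Cauchy_Schwarz_ineq2 by simp
      also have "\<dots> \<le> norm (h x) * 1" by (intro mult_left_mono v(2)) simp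
      finally show "norm (h x \<bullet> v n x) \<le> norm (h x)" by simp
    qed
    show "(\<lambda>x. h x \<bullet> v n x) \<in> borel_measurable (lebesgue_on \<Omega>)" for n
      using h test_function_measurable[OF \<Omega> v(1)] by measurable
  qed (use assms(3) h in auto)
  then have "\<forall>\<^sub>F n in sequentially. (LINT x|lebesgue_on \<Omega>. norm (h x)) - e < (LINT x|lebesgue_on \<Omega>. h x \<bullet> v n x)"
    using assms(4) by (intro order_tendstoD) auto
  then obtain n where "(LINT x|lebesgue_on \<Omega>. norm (h x)) - e < (LINT x|lebesgue_on \<Omega>. h x \<bullet> v n x)"
    by (meson eventually_sequentially order_refl)
  with v that show thesis by blast
qed


section \<open>Densities plus singular measures\<close>

text \<open>Pushing \<open>M\<close> forward along the identity yields a finite Borel measure on the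
  whole space, to which inner regularity by compact sets applies; it agrees with \<open>M\<close> on
  Borel subsets of \<open>N\<close>.\<close>

lemma finite_measure_inner_regular:
  assumes \<Omega>: "\<Omega> \<in> sets borel" and M: "finite_measure M" "sets M = borel_subsets \<Omega>"
    and N: "N \<in> borel_subsets \<Omega>" and "\<delta> > 0"
  obtains K where "compact K" "K \<subseteq> N" "measure M (N - K) < \<delta>"
proof -
  interpret M: finite_measure M by fact
  have spM: "space M = \<Omega>"
    using sets_eq_imp_space_eq[OF M(2)] by (simp add: space_restrict_space)
  have id: "(\<lambda>x. x) \<in> measurable M borel"
    using M(2) by (auto simp: measurable_def spM sets_restrict_space)
  let ?M = "distr M borel (\<lambda>x. x)"
  note N' = borel_subsetsD[OF \<Omega> N]
  have em: "emeasure ?M A = emeasure M A" if "A \<in> sets borel" "A \<subseteq> N" for A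
    using that id N' by (subst emeasure_distr) (auto simp: spM intro!: arg_cong[where f="emeasure M"])
  have "finite_measure ?M" by (rule M.finite_measure_distr[OF id])
  then have fin: "emeasure ?M (space ?M) \<noteq> \<infinity>"
    using finite_measure.emeasure_finite by fastforce
  have reg: "emeasure M N = (SUP K\<in>{K. K \<subseteq> N \<and> compact K}. emeasure ?M K)"
    using inner_regular[OF _ fin N'(1)] em[OF N'(1)] by simp
  show thesis
  proof (cases "measure M N < \<delta>")
    case True
    then show thesis by (intro that[of "{}"]) auto
  next
    case False
    \<comment> \<open>In this case the difference is nonnegative, so \<open>ennreal\<close> does not
      truncate it and the estimate for \<open>K\<close> can be read back in the reals.\<close>
    have "ennreal (measure M N - \<delta>) < ennreal (measure M N)"
      using False \<open>\<delta> > 0\<close> by (intro ennreal_lessI) auto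
    then have "ennreal (measure M N - \<delta>) < (SUP K\<in>{K. K \<subseteq> N \<and> compact K}. emeasure ?M K)"
      unfolding reg[symmetric] M.emeasure_eq_measure .
    then obtain K where K: "K \<subseteq> N" "compact K" "ennreal (measure M N - \<delta>) < emeasure ?M K"
      unfolding less_SUP_iff by blast
    have "K \<in> sets borel" using K(2) by (simp add: borel_compact)
    then have KM: "K \<in> sets M" "emeasure ?M K = ennreal (measure M K)"
      using K N' \<Omega> em[of K] by (auto simp: M(2) sets_restrict_space_iff M.emeasure_eq_measure)
    have "measure M N - \<delta> < measure M K"
      using K(3) False unfolding KM(2) by (simp add: ennreal_less_iff)
    moreover have "measure M (N - K) = measure M N - measure M K"
      using KM(1) K(1) N M(2) by (intro M.finite_measure_Diff) auto
    ultimately show thesis using K by (intro that[of K]) auto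
  qed
qed

lemma positive_part_null:
  assumes "vector_measure \<Omega> \<mu>" "A \<in> borel_subsets \<Omega>" "\<And>B. B \<in> borel_subsets \<Omega> \<Longrightarrow> B \<subseteq> A \<Longrightarrow> \<mu> B = 0"
  shows "emeasure (positive_part \<Omega> \<mu>) A = 0"
proof -
  have "pos_variation \<Omega> \<mu> A \<le> 0"
    unfolding pos_variation_def using assms(3) by (intro SUP_least) simp
  then show ?thesis using assms(1,2) by (simp add: emeasure_positive_part)
qed

text \<open>Inside the null set \<open>N\<close> carrying \<open>s\<close>, inner regularity gives
  one compact set for each of the finitely many coordinate Jordan parts. Their union is compact,
  still null, and good for all parts at once.\<close>

lemma singular_compact_carrier:
  fixes s :: "(real^'n) set \<Rightarrow> 'v::euclidean_space"
  assumes \<Omega>: "\<Omega> \<in> sets borel" and s: "vector_measure \<Omega> s" "lebesgue_singular \<Omega> s" and "\<delta> > 0"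
  obtains K where "compact K" "K \<subseteq> \<Omega>" "emeasure lborel K = 0"
    "\<And>b. b \<in> Basis \<Longrightarrow> measure (positive_part \<Omega> (\<lambda>A. s A \<bullet> b)) (\<Omega> - K) < \<delta>"
    "\<And>b. b \<in> Basis \<Longrightarrow> measure (positive_part \<Omega> (\<lambda>A. - (s A \<bullet> b))) (\<Omega> - K) < \<delta>"
proof -
  define \<mu> where "\<mu> p = (\<lambda>A. if snd p then s A \<bullet> fst p else - (s A \<bullet> fst p))" for p :: "'v \<times> bool"
  have \<mu>: "vector_measure \<Omega> (\<mu> p)" for p
    unfolding \<mu>_def using vector_measure_inner[OF s(1)] vector_measure_uminus[OF vector_measure_inner[OF s(1)]]
    by (cases "snd p") simp_all
  let ?M = "\<lambda>p. positive_part \<Omega> (\<mu> p)"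
  have fin: "finite_measure (?M p)" for p by (rule finite_measure_positive_part[OF \<mu>])
  obtain N where N: "N \<in> borel_subsets \<Omega>" "emeasure lborel N = 0"
    "\<And>A. A \<in> borel_subsets \<Omega> \<Longrightarrow> A \<inter> N = {} \<Longrightarrow> s A = 0"
    using s(2) unfolding lebesgue_singular_def by blast
  note N' = borel_subsetsD[OF \<Omega> N(1)]
  have "\<exists>K. compact K \<and> K \<subseteq> N \<and> measure (?M p) (N - K) < \<delta>" for p
    by (rule finite_measure_inner_regular[OF \<Omega> fin sets_positive_part N(1) \<open>\<delta> > 0\<close>]) blast
  then obtain Kp where Kp: "\<And>p. compact (Kp p)" "\<And>p. Kp p \<subseteq> N" "\<And>p. measure (?M p) (N - Kp p) < \<delta>" by metis
  define K where "K = (\<Union>p\<in>(Basis :: 'v set) \<times> UNIV. Kp p)"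
  have K: "compact K" "K \<subseteq> N"
    unfolding K_def by (intro compact_UN UN_least Kp finite_cartesian_product; simp)+
  have Kb: "K \<in> borel_subsets \<Omega>"
    using K N' \<Omega> by (auto simp: sets_restrict_space_iff borel_compact)
  have \<Omega>': "\<Omega> \<in> borel_subsets \<Omega>" using \<Omega> by (auto simp: sets_restrict_space)
  have small: "measure (?M p) (\<Omega> - K) < \<delta>" if p: "p \<in> Basis \<times> UNIV" for p
  proof -
    interpret finite_measure "?M p" by (rule fin)
    have "emeasure (?M p) (\<Omega> - N) = 0"
    proof (rule positive_part_null[OF \<mu>])
      show "\<mu> p B = 0" if "B \<in> borel_subsets \<Omega>" "B \<subseteq> \<Omega> - N" for B
      proof -
        have "B \<inter> N = {}" using that by blast
        then show ?thesis using N(3)[OF that(1)] by (simp add: \<mu>_def)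
      qed
    qed (use N(1) \<Omega>' in auto)
    then have 0: "measure (?M p) (\<Omega> - N) = 0" by (simp add: measure_def)
    have eq: "\<Omega> - K = (\<Omega> - N) \<union> (N - K)" using K(2) N'(2) by blast
    have "measure (?M p) (\<Omega> - K) = measure (?M p) (\<Omega> - N) + measure (?M p) (N - K)"
      unfolding eq using N(1) Kb \<Omega>' by (intro finite_measure_Union) (auto simp: sets_positive_part)
    also have "\<dots> \<le> measure (?M p) (N - Kp p)"
    proof -
      have "Kp p \<subseteq> K" using p unfolding K_def by blast
      moreover have "Kp p \<in> borel_subsets \<Omega>"
        using Kp(1,2)[of p] N' \<Omega> by (auto simp: sets_restrict_space_iff borel_compact)
      ultimately show ?thesis
        unfolding 0 add_0_left using N(1) by (intro finite_measure_mono) (auto simp: sets_positive_part)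
    qed
    finally show ?thesis using Kp(3)[of p] by simp
  qed
  show thesis
  proof (rule that[OF K(1)])
    show "K \<subseteq> \<Omega>" using K(2) N'(2) by blast
    show "emeasure lborel K = 0"
      using emeasure_mono[of K N lborel] K(2) N' N(2) by simp
    show "measure (positive_part \<Omega> (\<lambda>A. s A \<bullet> b)) (\<Omega> - K) < \<delta>" if "b \<in> Basis" for b
      using small[of "(b, True)"] that by (simp add: \<mu>_def)
    show "measure (positive_part \<Omega> (\<lambda>A. - (s A \<bullet> b))) (\<Omega> - K) < \<delta>" if "b \<in> Basis" for b
      using small[of "(b, False)"] that by (simp add: \<mu>_def)
  qed
qed

text \<open>Since \<open>f\<close> vanishes on \<open>K\<close>, its absolute value is dominated by
  \<open>B\<close> times the indicator of \<open>\<Omega> - K\<close>, for both Jordan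
  parts.\<close>

lemma signed_integral_bound:
  assumes \<Omega>: "\<Omega> \<in> sets borel" and \<mu>: "vector_measure \<Omega> \<mu>" and f: "f \<in> bounded_borel \<Omega>"
    and K: "K \<in> borel_subsets \<Omega>" "\<And>x. x \<in> K \<Longrightarrow> f x = 0" and B: "\<And>x. x \<in> \<Omega> \<Longrightarrow> \<bar>f x\<bar> \<le> B"
  shows "\<bar>signed_integral \<Omega> \<mu> f\<bar> \<le>
    B * (measure (positive_part \<Omega> \<mu>) (\<Omega> - K) + measure (positive_part \<Omega> (\<lambda>A. - \<mu> A)) (\<Omega> - K))"
proof -
  have bound: "\<bar>LINT x|positive_part \<Omega> \<mu>. f x\<bar> \<le> B * measure (positive_part \<Omega> \<mu>) (\<Omega> - K)"
    if \<mu>: "vector_measure \<Omega> \<mu>" for \<mu>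
  proof -
    let ?M = "positive_part \<Omega> \<mu>"
    interpret finite_measure ?M by (rule finite_measure_positive_part[OF \<mu>])
    have \<Omega>': "\<Omega> \<in> borel_subsets \<Omega>" using \<Omega> by (auto simp: sets_restrict_space)
    then have D: "\<Omega> - K \<in> sets ?M" using K(1) by (auto simp: sets_positive_part)
    have "\<bar>LINT x|?M. f x\<bar> \<le> (LINT x|?M. \<bar>f x\<bar>)" by (rule integral_abs_bound)
    also have "\<dots> \<le> (LINT x|?M. B * indicator (\<Omega> - K) x)"
    proof (rule integral_mono)
      show "integrable ?M (\<lambda>x. \<bar>f x\<bar>)" using integrable_positive_part[OF \<mu> f] by simp
      show "integrable ?M (\<lambda>x. B * indicator (\<Omega> - K) x)" using D emeasure_finite by (simp add: less_top[symmetric])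
      show "\<bar>f x\<bar> \<le> B * indicator (\<Omega> - K) x" if "x \<in> space ?M" for x
        using that K(2) B by (auto simp: space_positive_part indicator_def)
    qed
    also have "\<dots> = B * measure ?M (\<Omega> - K)" using D by (simp add: space_positive_part Int_absorb2)
    finally show ?thesis .
  qed
  show ?thesis
    using bound[OF \<mu>] bound[OF vector_measure_uminus[OF \<mu>]] unfolding signed_integral_def distrib_left by linarith
qed

lemma measure_integral_add:
  assumes "vector_measure \<Omega> s"
    and "\<And>b. b \<in> Basis \<Longrightarrow> (\<lambda>x. v x \<bullet> b) \<in> bounded_borel \<Omega>" "\<And>b. b \<in> Basis \<Longrightarrow> (\<lambda>x. w x \<bullet> b) \<in> bounded_borel \<Omega>"
  shows "measure_integral \<Omega> s (\<lambda>x. v x + w x) = measure_integral \<Omega> s v + measure_integral \<Omega> s w"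
  unfolding measure_integral_eq inner_add_left using assms
  by (simp add: signed_integral_add vector_measure_inner sum.distrib)

lemma measure_integral_decompose:
  fixes g :: "real^'n \<Rightarrow> 'v::euclidean_space"
  assumes \<Omega>: "\<Omega> \<in> sets borel" and m: "vector_measure \<Omega> m" and s: "vector_measure \<Omega> s"
    and g: "integrable (lebesgue_on \<Omega>) g"
    and eq: "\<And>A. A \<in> borel_subsets \<Omega> \<Longrightarrow> m A = (LINT x|lebesgue_on A. g x) + s A"
    and v: "test_function \<Omega> v"
  shows "measure_integral \<Omega> m v = (LINT x|lebesgue_on \<Omega>. g x \<bullet> v x) + measure_integral \<Omega> s v"
proof -
  have gb: "integrable (lebesgue_on \<Omega>) (\<lambda>x. g x \<bullet> b)" for b using g by simp
  have vb: "(\<lambda>x. v x \<bullet> b) \<in> bounded_borel \<Omega>" for b by (rule test_function_bounded_borel[OF v])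
  have "signed_integral \<Omega> (\<lambda>A. m A \<bullet> b) (\<lambda>x. v x \<bullet> b) =
      (LINT x|lebesgue_on \<Omega>. (g x \<bullet> b) * (v x \<bullet> b)) + signed_integral \<Omega> (\<lambda>A. s A \<bullet> b) (\<lambda>x. v x \<bullet> b)" for b
    by (rule signed_integral_decompose[OF \<Omega> vector_measure_inner[OF m] vector_measure_inner[OF s] gb _ vb])
      (simp add: eq inner_add_left integral_inner_lebesgue_on[OF \<Omega> _ g])
  then show ?thesis
    unfolding measure_integral_eq
    by (simp add: sum.distrib euclidean_inner[of "g _" "v _"] integrable_mult_bounded_borel[OF \<Omega> gb vb])
qed

section \<open>Cutoffs around a compact null set and gluing\<close>

lemma eventually_dist_compact_ge:
  assumes "compact K" "x \<notin> K"
  shows "\<exists>n0. \<forall>n\<ge>n0. \<forall>y\<in>K. dist y x \<ge> inverse (real (Suc n))"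
proof -
  have "open (- K)" using assms(1) by (simp add: compact_imp_closed open_Compl)
  then obtain e where e: "e > 0" "ball x e \<subseteq> - K" using assms(2) open_contains_ball by blast
  obtain n0 where n0: "inverse (real (Suc n0)) < e" using reals_Archimedean[OF e(1)] by blast
  have "inverse (real (Suc n)) \<le> dist y x" if "n \<ge> n0" "y \<in> K" for n y
  proof -
    have "inverse (real (Suc n)) \<le> inverse (real (Suc n0))" using that(1) by simp
    moreover have "e \<le> dist y x" using e(2) that(2) by (force simp: dist_commute)
    ultimately show ?thesis using n0 by linarith
  qed
  then show ?thesis by blast
qed

text \<open>On \<open>K\<close> the tolerance \<open>inverse (Suc n)\<close> of the cutoffs tends to
  0. A point off \<open>K\<close> has positive distance from \<open>K\<close>, hence eventually
  leaves the shrinking neighbourhoods \<open>U n\<close>, in which the cutoffs are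
  supported.\<close>

lemma smooth_cutoffs_tendsto_indicator:
  fixes K \<Omega> :: "(real^'n) set"
  assumes "compact K" "open \<Omega>" "K \<subseteq> \<Omega>"
  obtains \<eta> :: "nat \<Rightarrow> real^'n \<Rightarrow> real"
  where "\<And>n. test_function \<Omega> (\<eta> n)" "\<And>n x. 0 \<le> \<eta> n x" "\<And>n x. \<eta> n x \<le> 1"
    "\<And>x. (\<lambda>n. \<eta> n x) \<longlonglongrightarrow> indicator K x"
proof -
  define U where "U n = \<Omega> \<inter> (\<Union>y\<in>K. ball y (inverse (real (Suc n))))" for n
  have U: "open (U n)" "K \<subseteq> U n" for n
    unfolding U_def using assms(2,3) by (auto intro!: open_Int open_UN)
  have "\<exists>\<eta>. test_function (U n) \<eta> \<and> (\<forall>x. 0 \<le> \<eta> x \<and> \<eta> x \<le> 1) \<and> (\<forall>x\<in>K. 1 - inverse (real (Suc n)) \<le> \<eta> x)" for n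
    by (rule smooth_cutoff[OF assms(1) U(1)[of n] U(2)[of n], of "inverse (Suc n)"]) auto
  then obtain \<eta> where \<eta>: "\<And>n. test_function (U n) (\<eta> n)" "\<And>n x. 0 \<le> \<eta> n x" "\<And>n x. \<eta> n x \<le> 1"
    "\<And>n x. x \<in> K \<Longrightarrow> 1 - inverse (Suc n) \<le> \<eta> n x" by metis
  have t\<Omega>: "test_function \<Omega> (\<eta> n)" for n
    using \<eta>(1)[of n] unfolding test_function_def U_def by blast
  have "(\<lambda>n. \<eta> n x) \<longlonglongrightarrow> indicator K x" for x
  proof (cases "x \<in> K")
    case True
    have "(\<lambda>n. \<eta> n x) \<longlonglongrightarrow> 1"
    proof (rule tendsto_sandwich)
      show "\<forall>\<^sub>F n in sequentially. 1 - inverse (real (Suc n)) \<le> \<eta> n x"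
        using \<eta>(4)[OF True] by (intro always_eventually allI)
      show "(\<lambda>n. 1 - inverse (real (Suc n))) \<longlonglongrightarrow> 1"
        using tendsto_diff[OF tendsto_const LIMSEQ_inverse_real_of_nat, of 1] by simp
    qed (auto simp: \<eta>(3))
    with True show ?thesis by simp
  next
    case False
    obtain n0 where n0: "\<And>n y. n \<ge> n0 \<Longrightarrow> y \<in> K \<Longrightarrow> dist y x \<ge> inverse (real (Suc n))"
      using eventually_dist_compact_ge[OF assms(1) False] by blast
    have "\<eta> n x = 0" if "n \<ge> n0" for n
    proof -
      have "x \<notin> U n" using n0[OF that] unfolding U_def by (auto simp: not_less[symmetric])
      moreover obtain S where "S \<subseteq> U n" "\<And>x. x \<notin> S \<Longrightarrow> \<eta> n x = 0"
        by (rule test_functionE[OF \<eta>(1)[of n]]) (rule that)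
      ultimately show ?thesis by blast
    qed
    then have "(\<lambda>n. \<eta> n x) \<longlonglongrightarrow> 0"
      by (intro tendsto_eventually eventually_sequentiallyI)
    with False show ?thesis by simp
  qed
  with t\<Omega> \<eta>(2,3) show thesis by (rule that)
qed

text \<open>Cutoffs \<open>\<eta>\<^sub>n\<close> tending pointwise to the indicator of the compact null set \<open>K\<close> yield
  \<open>z\<^sub>n = \<eta>\<^sub>n w + (1 - \<eta>\<^sub>n) v\<close>, which tends to \<open>v\<close> Lebesgue-almost everywhere and to \<open>w\<close> on \<open>K\<close>.\<close>

lemma glue_test_functions:
  fixes h v w :: "real^'n \<Rightarrow> 'v::euclidean_space"
  assumes "open \<Omega>" and h: "integrable (lebesgue_on \<Omega>) h"
    and s: "vector_measure \<Omega> s" "lebesgue_singular \<Omega> s"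
    and v: "test_function \<Omega> v" "\<And>x. norm (v x) \<le> 1"
    and w: "test_function \<Omega> w" "\<And>x. norm (w x) \<le> 1" and "e > 0"
  obtains z where "test_function \<Omega> z" "\<And>x. norm (z x) \<le> 1"
    "(LINT x|lebesgue_on \<Omega>. h x \<bullet> v x) + measure_integral \<Omega> s w - e
      < (LINT x|lebesgue_on \<Omega>. h x \<bullet> z x) + measure_integral \<Omega> s z"
proof -
  have \<Omega>: "\<Omega> \<in> sets borel" using assms(1) by simp
  \<comment> \<open>Each coordinate of the error integrand is at most 2 in absolute value and meets
    two Jordan parts of mass below \<delta>, so it costs at most 4\<delta>; over all
    \<open>DIM('v)\<close> coordinates this makes \<open>e / 2\<close>.\<close>
  define \<delta> where "\<delta> = e / (8 * real DIM('v))"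
  have \<delta>: "\<delta> > 0" unfolding \<delta>_def using \<open>e > 0\<close> by simp
  obtain K where K: "compact K" "K \<subseteq> \<Omega>" "emeasure lborel K = 0"
    "\<And>b. b \<in> Basis \<Longrightarrow> measure (positive_part \<Omega> (\<lambda>A. s A \<bullet> b)) (\<Omega> - K) < \<delta>"
    "\<And>b. b \<in> Basis \<Longrightarrow> measure (positive_part \<Omega> (\<lambda>A. - (s A \<bullet> b))) (\<Omega> - K) < \<delta>"
    by (rule singular_compact_carrier[OF \<Omega> s \<delta>]) (rule that)
  have Kb: "K \<in> sets borel" using K(1) by (simp add: borel_compact)
  then have K\<Omega>: "K \<in> borel_subsets \<Omega>" using K(2) \<Omega> by (simp add: sets_restrict_space_iff)
  obtain \<eta> :: "nat \<Rightarrow> real^'n \<Rightarrow> real" where \<eta>: "\<And>n. test_function \<Omega> (\<eta> n)" "\<And>n x. 0 \<le> \<eta> n x" "\<And>n x. \<eta> n x \<le> 1"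
    "\<And>x. (\<lambda>n. \<eta> n x) \<longlonglongrightarrow> indicator K x"
    by (rule smooth_cutoffs_tendsto_indicator[OF K(1) assms(1) K(2)]) (rule that)
  define z where "z n x = \<eta> n x *\<^sub>R w x + (1 - \<eta> n x) *\<^sub>R v x" for n x
  \<comment> \<open>The pointwise limit of the glued functions: \<open>w\<close> on
    \<open>K\<close>, \<open>v\<close> elsewhere.\<close>
  define z' where "z' x = indicator K x *\<^sub>R w x + (1 - indicator K x) *\<^sub>R v x" for x
  \<comment> \<open>The difference of \<open>z'\<close> and \<open>w\<close>. It vanishes on
    \<open>K\<close>, so only the small mass of \<open>s\<close> off \<open>K\<close> sees
    it.\<close>
  define d where "d x = (1 - indicator K x) *\<^sub>R (v x - w x)" for x
  have Ck\<eta>: "Ck k (\<eta> n)" for k n using \<eta>(1) unfolding test_function_def by blast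
  have tz: "test_function \<Omega> (z n)" for n
    unfolding z_def by (intro test_function_combine w(1) v(1) Ck\<eta> Ck_diff Ck_const)
  have nz: "norm (z n x) \<le> 1" for n x
  proof -
    have "norm (z n x) \<le> norm (\<eta> n x *\<^sub>R w x) + norm ((1 - \<eta> n x) *\<^sub>R v x)"
      unfolding z_def by (rule norm_triangle_ineq)
    also have "\<dots> = \<eta> n x * norm (w x) + (1 - \<eta> n x) * norm (v x)"
      using \<eta>(2,3) by simp
    also have "\<dots> \<le> \<eta> n x * 1 + (1 - \<eta> n x) * 1"
      using \<eta>(2,3)[of n x] v(2)[of x] w(2)[of x] by (intro add_mono mult_left_mono) auto
    finally show ?thesis by simp
  qed
  have limz: "(\<lambda>n. z n x) \<longlonglongrightarrow> z' x" for x
    unfolding z_def z'_def by (intro tendsto_intros \<eta>(4))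
  have vwb: "(\<lambda>x. v x \<bullet> b) \<in> bounded_borel \<Omega>" "(\<lambda>x. w x \<bullet> b) \<in> bounded_borel \<Omega>" "(\<lambda>x. z n x \<bullet> b) \<in> bounded_borel \<Omega>" for b n
    by (intro test_function_bounded_borel v(1) w(1) tz)+
  have "(\<lambda>x. 1 - indicator K x :: real) \<in> borel_measurable borel" using Kb by measurable
  then have Kbb: "(\<lambda>x. 1 - indicator K x :: real) \<in> bounded_borel \<Omega>"
    by (intro bounded_borelI[where B=1] measurable_restrict_space1) (auto simp: indicator_def)
  have db: "(\<lambda>x. d x \<bullet> b) \<in> bounded_borel \<Omega>" for b
  proof -
    have "(\<lambda>x. (1 - indicator K x) * (v x \<bullet> b + (-1) * (w x \<bullet> b))) \<in> bounded_borel \<Omega>"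
      by (intro bounded_borel_mult bounded_borel_add bounded_borel_const Kbb vwb)
    then show ?thesis by (simp add: d_def inner_diff_left)
  qed
  have z'd: "z' x = w x + d x" for x
    unfolding z'_def d_def by (simp add: algebra_simps)
  have z'b: "(\<lambda>x. z' x \<bullet> b) \<in> bounded_borel \<Omega>" for b
    unfolding z'd inner_add_left by (intro bounded_borel_add vwb db)
  have "(\<lambda>n. LINT x|lebesgue_on \<Omega>. h x \<bullet> z n x) \<longlonglongrightarrow> (LINT x|lebesgue_on \<Omega>. h x \<bullet> v x)"
  proof (rule integral_dominated_convergence[where w="\<lambda>x. norm (h x)"])
    show "(\<lambda>x. h x \<bullet> v x) \<in> borel_measurable (lebesgue_on \<Omega>)" "(\<lambda>x. h x \<bullet> z n x) \<in> borel_measurable (lebesgue_on \<Omega>)" for n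
      using integrable_inner_test_function[OF \<Omega> h] v(1) tz by blast+
    show "integrable (lebesgue_on \<Omega>) (\<lambda>x. norm (h x))" using h by simp
    have "AE x in lebesgue. x \<notin> K"
      using K(3) Kb by (intro AE_not_in) (auto simp: null_sets_def)
    then have "AE x in lebesgue_on \<Omega>. x \<notin> K"
      using \<Omega> by (subst AE_restrict_space_iff) auto
    then show "AE x in lebesgue_on \<Omega>. (\<lambda>n. h x \<bullet> z n x) \<longlonglongrightarrow> h x \<bullet> v x"
    proof eventually_elim
      case (elim x)
      then have "z' x = v x" by (simp add: z'_def)
      with tendsto_inner[OF tendsto_const limz[of x], of "h x"] show ?case by simp
    qed
    show "AE x in lebesgue_on \<Omega>. norm (h x \<bullet> z n x) \<le> norm (h x)" for n
    proof (rule AE_I2)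
      fix x
      have "norm (h x \<bullet> z n x) \<le> norm (h x) * norm (z n x)" using Cauchy_Schwarz_ineq2 by simp
      also have "\<dots> \<le> norm (h x) * 1" by (intro mult_left_mono nz) simp
      finally show "norm (h x \<bullet> z n x) \<le> norm (h x)" by simp
    qed
  qed
  moreover have "(\<lambda>n. measure_integral \<Omega> s (z n)) \<longlonglongrightarrow> measure_integral \<Omega> s z'"
    unfolding measure_integral_eq
  proof (rule tendsto_sum)
    fix b :: 'v assume b: "b \<in> Basis"
    show "(\<lambda>n. signed_integral \<Omega> (\<lambda>A. s A \<bullet> b) (\<lambda>x. z n x \<bullet> b)) \<longlonglongrightarrow> signed_integral \<Omega> (\<lambda>A. s A \<bullet> b) (\<lambda>x. z' x \<bullet> b)"
    proof (rule signed_integral_dominated_convergence[OF vector_measure_inner[OF s(1)], where B=1])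
      show "(\<lambda>x. z n x \<bullet> b) \<in> borel_measurable (restrict_space borel \<Omega>)" "(\<lambda>x. z' x \<bullet> b) \<in> borel_measurable (restrict_space borel \<Omega>)" for n
        using vwb(3) z'b unfolding bounded_borel_def by blast+
      show "\<bar>z n x \<bullet> b\<bar> \<le> 1" for n x using Basis_le_norm[OF b, of "z n x"] nz[of n x] by linarith
      show "(\<lambda>n. z n x \<bullet> b) \<longlonglongrightarrow> z' x \<bullet> b" for x by (intro tendsto_inner tendsto_const limz)
    qed
  qed
  ultimately have "(\<lambda>n. (LINT x|lebesgue_on \<Omega>. h x \<bullet> z n x) + measure_integral \<Omega> s (z n))
      \<longlonglongrightarrow> (LINT x|lebesgue_on \<Omega>. h x \<bullet> v x) + measure_integral \<Omega> s z'"
    by (rule tendsto_add)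
  moreover have "measure_integral \<Omega> s z' = measure_integral \<Omega> s w + measure_integral \<Omega> s d"
    unfolding z'd by (rule measure_integral_add[OF s(1) vwb(2) db])
  moreover have "\<bar>measure_integral \<Omega> s d\<bar> \<le> e / 2"
  proof -
    have "\<bar>signed_integral \<Omega> (\<lambda>A. s A \<bullet> b) (\<lambda>x. d x \<bullet> b)\<bar> \<le> 4 * \<delta>" if b: "b \<in> Basis" for b
    proof -
      have "\<bar>signed_integral \<Omega> (\<lambda>A. s A \<bullet> b) (\<lambda>x. d x \<bullet> b)\<bar> \<le>
        2 * (measure (positive_part \<Omega> (\<lambda>A. s A \<bullet> b)) (\<Omega> - K) + measure (positive_part \<Omega> (\<lambda>A. - (s A \<bullet> b))) (\<Omega> - K))"
      proof (rule signed_integral_bound[OF \<Omega> vector_measure_inner[OF s(1)] db K\<Omega>])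
        show "d x \<bullet> b = 0" if "x \<in> K" for x using that by (simp add: d_def)
        show "\<bar>d x \<bullet> b\<bar> \<le> 2" for x
        proof -
          have "norm (d x) \<le> norm (v x - w x)" unfolding d_def by (auto simp: indicator_def)
          also have "\<dots> \<le> 2" using norm_triangle_ineq4[of "v x" "w x"] v(2)[of x] w(2)[of x] by linarith
          finally show ?thesis using Basis_le_norm[OF b, of "d x"] by linarith
        qed
      qed
      also have "\<dots> \<le> 2 * (\<delta> + \<delta>)"
        using K(4,5)[OF b] by (intro mult_left_mono add_mono less_imp_le) auto
      finally show ?thesis by simp
    qed
    then have "(\<Sum>b\<in>Basis. \<bar>signed_integral \<Omega> (\<lambda>A. s A \<bullet> b) (\<lambda>x. d x \<bullet> b)\<bar>) \<le> (\<Sum>b\<in>(Basis :: 'v set). 4 * \<delta>)"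
      by (rule sum_mono)
    also have "\<dots> = e / 2" unfolding \<delta>_def by simp
    finally show ?thesis
      unfolding measure_integral_eq by (rule order_trans[OF sum_abs])
  qed
  \<comment> \<open>The limit falls short of the target by at most \<open>e / 2\<close>; the other
    half of \<open>e\<close> makes the inequality strict, hence valid for large
    \<open>n\<close>.\<close>
  ultimately have "\<forall>\<^sub>F n in sequentially. (LINT x|lebesgue_on \<Omega>. h x \<bullet> v x) + measure_integral \<Omega> s w - e
      < (LINT x|lebesgue_on \<Omega>. h x \<bullet> z n x) + measure_integral \<Omega> s (z n)"
    using \<open>e > 0\<close> by (intro order_tendstoD(1)) (assumption, linarith)
  then obtain n where "(LINT x|lebesgue_on \<Omega>. h x \<bullet> v x) + measure_integral \<Omega> s w - e
      < (LINT x|lebesgue_on \<Omega>. h x \<bullet> z n x) + measure_integral \<Omega> s (z n)"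
    by (meson eventually_sequentially order_refl)
  then show thesis by (rule that[OF tz nz])
qed

text \<open>For a competitor \<open>w\<close>, \<open>T\<^sub>1 w\<close> is at most the L1 norm of
  \<open>h\<^sub>1\<close>, hence of \<open>h\<^sub>2\<close>, plus the integral of \<open>w\<close>
  against \<open>s\<close>. Gluing \<open>w\<close> near the carrier of \<open>s\<close> to a nearly
  optimal \<open>v\<close> for \<open>h\<^sub>2\<close> elsewhere gives a competitor whose
  \<open>T\<^sub>2\<close>-value reaches this up to \<open>e\<close>: one half is lost in the
  duality, the other in the gluing.\<close>

lemma radon_norm_mono_density:
  fixes h\<^sub>1 h\<^sub>2 :: "real^'n \<Rightarrow> 'v::euclidean_space"
  assumes "open \<Omega>" "bounded \<Omega>"
    and h1: "integrable (lebesgue_on \<Omega>) h\<^sub>1" and h2: "integrable (lebesgue_on \<Omega>) h\<^sub>2"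
    and s: "vector_measure \<Omega> s" "lebesgue_singular \<Omega> s"
    and le: "(LINT x|lebesgue_on \<Omega>. norm (h\<^sub>1 x)) \<le> (LINT x|lebesgue_on \<Omega>. norm (h\<^sub>2 x))"
    and T1: "\<And>v. test_function \<Omega> v \<Longrightarrow> T\<^sub>1 v = (LINT x|lebesgue_on \<Omega>. h\<^sub>1 x \<bullet> v x) + measure_integral \<Omega> s v"
    and T2: "\<And>v. test_function \<Omega> v \<Longrightarrow> T\<^sub>2 v = (LINT x|lebesgue_on \<Omega>. h\<^sub>2 x \<bullet> v x) + measure_integral \<Omega> s v"
  shows "radon_norm \<Omega> T\<^sub>1 \<le> radon_norm \<Omega> T\<^sub>2"
  unfolding radon_norm_def[of \<Omega> T\<^sub>1]
proof (rule SUP_least)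
  fix w :: "real^'n \<Rightarrow> 'v" assume "w \<in> {v. test_function \<Omega> v \<and> (\<forall>x. norm (v x) \<le> 1)}"
  then have w: "test_function \<Omega> w" "\<And>x. norm (w x) \<le> 1" by auto
  have \<Omega>: "\<Omega> \<in> sets borel" using assms(1) by simp
  show "ereal (T\<^sub>1 w) \<le> radon_norm \<Omega> T\<^sub>2"
  proof (rule ereal_le_epsilon2)
    fix e :: real assume "0 < e"
    then have e2: "e / 2 > 0" by simp
    obtain v where v: "test_function \<Omega> v" "\<And>x. norm (v x) \<le> 1"
      "(LINT x|lebesgue_on \<Omega>. norm (h\<^sub>2 x)) - e / 2 < (LINT x|lebesgue_on \<Omega>. h\<^sub>2 x \<bullet> v x)"
      by (rule L1_duality[OF assms(1,2) h2 e2]) (rule that)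
    obtain z where z: "test_function \<Omega> z" "\<And>x. norm (z x) \<le> 1"
      "(LINT x|lebesgue_on \<Omega>. h\<^sub>2 x \<bullet> v x) + measure_integral \<Omega> s w - e / 2
        < (LINT x|lebesgue_on \<Omega>. h\<^sub>2 x \<bullet> z x) + measure_integral \<Omega> s z"
      by (rule glue_test_functions[OF assms(1) h2 s v(1,2) w e2]) (rule that)
    have "(LINT x|lebesgue_on \<Omega>. h\<^sub>1 x \<bullet> w x) \<le> (LINT x|lebesgue_on \<Omega>. norm (h\<^sub>1 x))"
    proof (rule integral_mono)
      show "integrable (lebesgue_on \<Omega>) (\<lambda>x. h\<^sub>1 x \<bullet> w x)" by (rule integrable_inner_test_function[OF \<Omega> h1 w(1)])
      show "h\<^sub>1 x \<bullet> w x \<le> norm (h\<^sub>1 x)" for x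
        using norm_cauchy_schwarz[of "h\<^sub>1 x" "w x"] mult_left_mono[OF w(2)[of x], of "norm (h\<^sub>1 x)"] by simp
    qed (use h1 in simp)
    then have "T\<^sub>1 w \<le> T\<^sub>2 z + e"
      using T1[OF w(1)] T2[OF z(1)] z(3) v(3) le by linarith
    then have "ereal (T\<^sub>1 w) \<le> ereal (T\<^sub>2 z) + ereal e" by simp
    also have "ereal (T\<^sub>2 z) \<le> radon_norm \<Omega> T\<^sub>2"
      unfolding radon_norm_def using z by (intro SUP_upper) auto
    finally show "ereal (T\<^sub>1 w) \<le> radon_norm \<Omega> T\<^sub>2 + ereal e" by (simp add: add_right_mono)
  qed
qed


section \<open>Infinitesimal rigid motions\<close>

lemma integrable_compact_support:
  fixes f :: "real^'n \<Rightarrow> 'v::euclidean_space"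
  assumes "continuous_on UNIV f" "compact S" "\<And>x. x \<notin> S \<Longrightarrow> f x = 0"
  shows "integrable lborel f"
proof -
  have "integrable lborel (\<lambda>x. indicator S x *\<^sub>R f x)"
    by (rule borel_integrable_compact[OF assms(2)]) (rule continuous_on_subset[OF assms(1)], simp)
  moreover have "(\<lambda>x. indicator S x *\<^sub>R f x) = f"
    using assms(3) by (auto simp: fun_eq_iff indicator_def)
  ultimately show ?thesis by simp
qed

text \<open>The function is its own extension by zero, so the domain can be traded for the whole
  space, where Lebesgue measure is translation invariant.\<close>

lemma lebesgue_on_compact_support:
  fixes f :: "real^'n \<Rightarrow> 'v::euclidean_space"
  assumes "\<Omega> \<in> sets borel" "continuous_on UNIV f" "compact S" "S \<subseteq> \<Omega>" "\<And>x. x \<notin> S \<Longrightarrow> f x = 0"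
  shows "integrable (lebesgue_on \<Omega>) f" "(LINT x|lebesgue_on \<Omega>. f x) = (LINT x|lborel. f x)"
proof -
  have eq: "(\<lambda>x. indicator \<Omega> x *\<^sub>R f x) = f"
    using assms(4,5) by (auto simp: fun_eq_iff indicator_def)
  have "f \<in> borel_measurable lborel" using assms(2) by (simp add: borel_measurable_continuous_onI)
  then show "(LINT x|lebesgue_on \<Omega>. f x) = (LINT x|lborel. f x)"
    using assms(1) by (simp add: integral_restrict_space eq integral_completion)
  show "integrable (lebesgue_on \<Omega>) f"
    using assms(1) integrable_compact_support[OF assms(2,3,5)]
    by (simp add: integrable_restrict_space eq integrable_completion \<open>f \<in> borel_measurable lborel\<close>)
qed

text \<open>The integral of a partial derivative is the limit of integrals of difference quotients, which
  vanish by translation invariance.\<close>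

lemma integral_partial_deriv_test_function:
  fixes \<phi> :: "real^'n \<Rightarrow> real"
  assumes \<Omega>: "\<Omega> \<in> sets borel" and \<phi>: "test_function \<Omega> \<phi>"
  shows "integrable (lebesgue_on \<Omega>) (partial_deriv j \<phi>)" "(LINT x|lebesgue_on \<Omega>. partial_deriv j \<phi> x) = 0"
proof -
  obtain S where S: "compact S" "S \<subseteq> \<Omega>" "\<And>x. x \<notin> S \<Longrightarrow> \<phi> x = 0" "\<And>k. Ck k \<phi>" "continuous_on UNIV \<phi>"
    by (rule test_functionE[OF \<phi>]) (rule that)
  define \<psi> where "\<psi> = partial_deriv j \<phi>"
  let ?e = "axis j 1 :: real^'n"
  have diff: "\<phi> differentiable (at x)" for x using S(4)[of "Suc 0"] by simp
  have \<psi>_cont: "continuous_on UNIV \<psi>" using S(4)[of "Suc 0"] by (simp add: \<psi>_def)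
  have \<psi>0: "\<psi> x = 0" if "x \<notin> S" for x
  proof -
    have "(\<phi> has_derivative (\<lambda>h. 0)) (at x)"
      by (rule has_derivative_transform_within_open[OF has_derivative_const, of "- S"])
        (use S that in \<open>auto simp: compact_imp_closed open_Compl\<close>)
    then show ?thesis unfolding \<psi>_def by (simp add: partial_deriv_eq)
  qed
  note L = lebesgue_on_compact_support[OF \<Omega> \<psi>_cont S(1,2) \<psi>0]
  \<comment> \<open>Used twice: at \<open>t = 0\<close> for the limit of the difference quotients,
    and along the whole segment for their mean value bound.\<close>
  have line: "((\<lambda>t. \<phi> (x + t *\<^sub>R ?e)) has_real_derivative \<psi> (x + t *\<^sub>R ?e)) (at t)" for x t
  proof -
    have d: "(\<phi> has_derivative frechet_derivative \<phi> (at y)) (at y)" for y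
      using diff frechet_derivative_works by blast
    have "((\<lambda>t. x + t *\<^sub>R ?e) has_derivative (\<lambda>s. s *\<^sub>R ?e)) (at t)"
      by (auto intro!: derivative_eq_intros)
    from has_derivative_compose[OF this d]
    have "((\<lambda>t. \<phi> (x + t *\<^sub>R ?e)) has_derivative (\<lambda>s. frechet_derivative \<phi> (at (x + t *\<^sub>R ?e)) (s *\<^sub>R ?e))) (at t)" .
    moreover have "frechet_derivative \<phi> (at y) (s *\<^sub>R ?e) = s * \<psi> y" for y s
      using linear_scale[OF linear_frechet_derivative[OF diff]] by (simp add: \<psi>_def partial_deriv_def)
    moreover have "(\<lambda>s. s * \<psi> (x + t *\<^sub>R ?e)) = (*) (\<psi> (x + t *\<^sub>R ?e))" by (auto simp: mult.commute)
    ultimately show ?thesis by (simp add: has_field_derivative_def)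
  qed
  define t where "t n = inverse (real (Suc n))" for n
  have t: "0 < t n" "t n \<le> 1" "t n \<noteq> 0" for n unfolding t_def by (auto simp: inverse_le_1_iff)
  have t0: "t \<longlonglongrightarrow> 0" unfolding t_def by (rule LIMSEQ_inverse_real_of_nat)
  define q where "q n x = (\<phi> (x + t n *\<^sub>R ?e) - \<phi> x) / t n" for n x
  have \<phi>_int: "integrable lborel \<phi>" by (rule integrable_compact_support[OF S(5,1,3)])
  have shift: "integrable lborel (\<lambda>x. \<phi> (x + a))" "(LINT x|lborel. \<phi> (x + a)) = (LINT x|lborel. \<phi> x)" for a
  proof -
    have "\<phi> \<in> borel_measurable borel" using S(5) by (rule borel_measurable_continuous_onI)
    then show "integrable lborel (\<lambda>x. \<phi> (x + a))" "(LINT x|lborel. \<phi> (x + a)) = (LINT x|lborel. \<phi> x)"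
      using \<phi>_int integrable_distr[of "(+) a" lborel borel \<phi>] integral_distr[of "(+) a" lborel borel \<phi>]
      by (simp_all add: lborel_distr_plus add.commute)
  qed
  have q0: "(LINT x|lborel. q n x) = 0" for n
    unfolding q_def using shift \<phi>_int by simp
  have lim: "(\<lambda>n. q n x) \<longlonglongrightarrow> \<psi> x" for x
  proof -
    have "((\<lambda>s. (\<phi> (x + s *\<^sub>R ?e) - \<phi> x) / s) \<longlongrightarrow> \<psi> x) (at 0)"
      using line[of x 0] by (simp add: DERIV_def)
    moreover have "filterlim t (at 0) sequentially"
      unfolding filterlim_at using t0 t(3) by simp
    ultimately show ?thesis unfolding q_def by (rule filterlim_compose)
  qed
  obtain B where B: "\<And>x. \<bar>\<psi> x\<bar> \<le> B" "B \<ge> 0"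
  proof -
    have "compact (\<psi> ` S)" using \<psi>_cont S(1) by (intro compact_continuous_image) (auto intro: continuous_on_subset)
    then obtain B where "\<And>y. y \<in> \<psi> ` S \<Longrightarrow> norm y \<le> B" using compact_imp_bounded bounded_iff by metis
    then have "\<bar>\<psi> x\<bar> \<le> max B 0" for x using \<psi>0[of x] by (cases "x \<in> S") (auto simp: le_max_iff_disj)
    then show thesis by (intro that[of "max B 0"]) auto
  qed
  obtain R where R: "\<And>x. x \<in> S \<Longrightarrow> norm x \<le> R" using compact_imp_bounded[OF S(1)] bounded_iff by metis
  \<comment> \<open>Steps have length at most 1, so outside the ball of radius \<open>R + 1\<close>
    neither \<open>x\<close> nor its translate meets \<open>S\<close> and the quotient vanishes.
    Inside, the mean value theorem bounds it by \<open>B\<close>.\<close>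
  have bound: "\<bar>q n x\<bar> \<le> indicator (cball 0 (R + 1)) x * B" for n x
  proof (cases "x \<in> cball 0 (R + 1)")
    case True
    obtain z where "0 < z" "z < t n" "\<phi> (x + t n *\<^sub>R ?e) - \<phi> (x + 0 *\<^sub>R ?e) = (t n - 0) * \<psi> (x + z *\<^sub>R ?e)"
      using MVT2[OF t(1)[of n] line, of x] by blast
    then have "q n x = \<psi> (x + z *\<^sub>R ?e)" unfolding q_def using t(3) by simp
    with B True show ?thesis by simp
  next
    case False
    then have "norm x > R + 1" by simp
    moreover have "norm x \<le> norm (x + t n *\<^sub>R ?e) + norm (t n *\<^sub>R ?e)"
      using norm_triangle_ineq4[of "x + t n *\<^sub>R ?e" "t n *\<^sub>R ?e"] by simp
    moreover have "norm (t n *\<^sub>R ?e) \<le> 1" using t(1,2)[of n] by (simp add: norm_axis_1)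
    ultimately have "x \<notin> S" "x + t n *\<^sub>R ?e \<notin> S" using R[of x] R[of "x + t n *\<^sub>R ?e"] by auto
    with False S(3) show ?thesis by (simp add: q_def)
  qed
  have "(\<lambda>n. LINT x|lborel. q n x) \<longlonglongrightarrow> (LINT x|lborel. \<psi> x)"
  proof (rule integral_dominated_convergence[where w="\<lambda>x. indicator (cball 0 (R + 1)) x * B"])
    have "integrable lborel (\<lambda>x::real^'n. indicator (cball 0 (R + 1)) x *\<^sub>R B)"
      by (rule borel_integrable_compact) auto
    then show "integrable lborel (\<lambda>x::real^'n. indicator (cball 0 (R + 1)) x * B)" by simp
    show "\<psi> \<in> borel_measurable lborel" using \<psi>_cont by (simp add: borel_measurable_continuous_onI)
    show "q n \<in> borel_measurable lborel" for n
      unfolding q_def using shift(1) \<phi>_int by (intro borel_measurable_integrable) simp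
  qed (use lim bound in auto)
  then have "(LINT x|lborel. \<psi> x) = 0" by (simp add: q0 LIMSEQ_const_iff)
  then show "integrable (lebesgue_on \<Omega>) (partial_deriv j \<phi>)" "(LINT x|lebesgue_on \<Omega>. partial_deriv j \<phi> x) = 0"
    using L by (simp_all add: \<psi>_def)
qed

section \<open>The symmetrised gradient of affine maps\<close>

text \<open>\<open>T (f x)\<close> is the bilinear map (c, y) to c T y evaluated at the constant c =
  1, so the Leibniz argument covers it.\<close>

lemma Ck_linear_compose: "bounded_linear T \<Longrightarrow> Ck k f \<Longrightarrow> Ck k (\<lambda>x. T (f x))"
  using Ck_bilinear[OF bounded_bilinear.comp[OF bounded_bilinear_scaleR bounded_linear_ident], of T k "\<lambda>x. 1" f]
  by (simp add: Ck_const)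

lemma test_function_linear_compose:
  assumes "bounded_linear T" "test_function \<Omega> v"
  shows "test_function \<Omega> (\<lambda>x. T (v x))"
proof -
  obtain S where S: "compact S" "S \<subseteq> \<Omega>" "\<And>x. x \<notin> S \<Longrightarrow> v x = 0" "\<And>k. Ck k v" "continuous_on UNIV v"
    by (rule test_functionE[OF assms(2)]) (rule that)
  interpret T: bounded_linear T by fact
  show ?thesis
  proof (rule test_functionI)
    show "{x. T (v x) \<noteq> 0} \<subseteq> S" using S(3) T.zero by fastforce
    show "Ck k (\<lambda>x. T (v x))" for k by (rule Ck_linear_compose[OF assms(1) S(4)])
  qed (use S in auto)
qed

lemma test_function_mult:
  fixes a f :: "real^'n \<Rightarrow> real"
  assumes "\<And>k. Ck k a" "test_function \<Omega> f"
  shows "test_function \<Omega> (\<lambda>x. a x * f x)"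
  using test_function_combine[OF assms(2) assms(2) assms(1) Ck_const[of _ 0]] by simp

lemma bounded_linear_matrix_entry: "bounded_linear (\<lambda>V :: real^'n^'m. V $ i $ j)"
  by (rule bounded_linear_compose[OF bounded_linear_vec_nth bounded_linear_vec_nth])

lemma bounded_linear_transpose: "bounded_linear (transpose :: real^'n^'m \<Rightarrow> real^'m^'n)"
  by (intro linear_conv_bounded_linear[THEN iffD1] linearI) (simp_all add: transpose_def vec_eq_iff)

text \<open>Integration by parts: an affine component times an entry of \<open>V\<close> is again a
  test function, so its partial derivatives integrate to 0 and only the constant derivative
  \<open>A $ i $ j\<close> of the affine factor survives.\<close>

lemma dist_jacobian_affine:
  fixes A :: "real^'n^'n"
  assumes \<Omega>: "\<Omega> \<in> sets borel" and V: "test_function \<Omega> V"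
  shows "dist_jacobian \<Omega> (\<lambda>x. A *v x + b) V = (\<Sum>i\<in>UNIV. \<Sum>j\<in>UNIV. A $ i $ j * (LINT x|lebesgue_on \<Omega>. V x $ i $ j))"
proof -
  let ?r = "\<lambda>x. A *v x + b"
  have Vij: "test_function \<Omega> (\<lambda>x. V x $ i $ j)" for i j
    by (rule test_function_linear_compose[OF bounded_linear_matrix_entry V])
  have blA: "bounded_linear (\<lambda>x. A *v x)" by (simp add: linear_conv_bounded_linear[symmetric])
  then have rd: "(?r has_derivative (\<lambda>h. A *v h)) (at x)" for x
    by (auto intro!: derivative_eq_intros bounded_linear_imp_has_derivative)
  have rid: "((\<lambda>x. ?r x $ i) has_derivative (\<lambda>h. (A *v h) $ i)) (at x)" for i x
    by (rule bounded_linear.has_derivative[OF bounded_linear_vec_nth rd])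
  have Ckr: "Ck k (\<lambda>x. ?r x $ i)" for k i
    by (rule Ck_linear_compose[OF bounded_linear_vec_nth])
      (intro Ck_add Ck_const Ck_bounded_linear blA)
  have \<phi>: "test_function \<Omega> (\<lambda>x. ?r x $ i * V x $ i $ j)" for i j
    by (rule test_function_mult[OF Ckr Vij])
  have Vd: "V differentiable (at x)" "(\<lambda>x. V x $ i $ j) differentiable (at x)" for x i j
    using V Vij[of i j] unfolding test_function_def by (metis Ck.simps(2))+
  have Vp: "partial_deriv k (\<lambda>x. V x $ i $ j) x = partial_deriv k V x $ i $ j" for k x i j
    using partial_deriv_eq[OF bounded_linear.has_derivative[OF bounded_linear_matrix_entry Vd(1)[unfolded frechet_derivative_works]]]
    by (simp add: partial_deriv_def)
  have eq: "?r x $ i * partial_deriv j V x $ i $ j =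
      partial_deriv j (\<lambda>x. ?r x $ i * V x $ i $ j) x - A $ i $ j * V x $ i $ j" for x i j
  proof -
    have "partial_deriv j (\<lambda>x. ?r x $ i) x = A $ i $ j"
      by (subst partial_deriv_eq[OF rid]) (simp add: matrix_vector_mul_component inner_axis)
    moreover have "(\<lambda>x. ?r x $ i) differentiable (at x)" using rid unfolding differentiable_def by blast
    ultimately show ?thesis
      using partial_deriv_bilinear[OF bounded_bilinear_mult _ Vd(2)[of i j x], of "\<lambda>x. ?r x $ i" j]
      by (simp add: Vp)
  qed
  have Vint: "integrable (lebesgue_on \<Omega>) (\<lambda>x. V x $ i $ j)" for i j
  proof -
    obtain S where "compact S" "S \<subseteq> \<Omega>" "\<And>x. x \<notin> S \<Longrightarrow> V x $ i $ j = 0" "continuous_on UNIV (\<lambda>x. V x $ i $ j)"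
      by (rule test_functionE[OF Vij[of i j]]) (rule that)
    then show ?thesis using lebesgue_on_compact_support(1)[OF \<Omega>] by blast
  qed
  show ?thesis
    unfolding dist_jacobian_def eq
    using integral_partial_deriv_test_function[OF \<Omega> \<phi>] Vint
    by (simp add: sum_negf[symmetric])
qed

text \<open>Transposing \<open>V\<close> amounts to transposing \<open>A\<close> in the double sum;
  skewness turns this into a change of sign, and the two Jacobian terms cancel.\<close>

lemma sym_grad_Ker_E:
  assumes \<Omega>: "\<Omega> \<in> sets borel" and r: "r \<in> Ker_E" and V: "test_function \<Omega> V"
  shows "sym_grad \<Omega> r V = 0"
proof -
  obtain A b where A: "transpose A = - A" and r: "r = (\<lambda>x. A *v x + b)"
    using r unfolding Ker_E_def by blast
  have skew: "A $ j $ i = - A $ i $ j" for i j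
    using arg_cong[OF A, of "\<lambda>M. M $ i $ j"] by (simp add: transpose_def)
  define a where "a i j = (LINT x|lebesgue_on \<Omega>. V x $ i $ j)" for i j
  have V': "test_function \<Omega> (\<lambda>x. transpose (V x))"
    by (rule test_function_linear_compose[OF bounded_linear_transpose V])
  have "dist_jacobian \<Omega> r (\<lambda>x. transpose (V x)) = (\<Sum>i\<in>UNIV. \<Sum>j\<in>UNIV. A $ i $ j * a j i)"
    unfolding r dist_jacobian_affine[OF \<Omega> V'] a_def by (simp add: transpose_def)
  also have "\<dots> = (\<Sum>i\<in>UNIV. \<Sum>j\<in>UNIV. A $ j $ i * a i j)" by (rule sum.swap)
  also have "\<dots> = (\<Sum>i\<in>UNIV. \<Sum>j\<in>UNIV. - (A $ i $ j * a i j))"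
    by (intro sum.cong refl) (subst skew, simp only: mult_minus_left)
  also have "\<dots> = - dist_jacobian \<Omega> r V"
    unfolding r dist_jacobian_affine[OF \<Omega> V] a_def[symmetric] by (simp only: sum_negf)
  finally show ?thesis unfolding sym_grad_def by simp
qed

lemma Ker_E_integrable:
  assumes "open \<Omega>" "bounded \<Omega>" and r: "r \<in> Ker_E"
  shows "integrable (lebesgue_on \<Omega>) r"
proof -
  obtain A b where r: "r = (\<lambda>x. A *v x + b)" using r unfolding Ker_E_def by blast
  have cont: "continuous_on UNIV r"
    unfolding r by (intro continuous_intros matrix_vector_mult_linear_continuous_on)
  have "compact (r ` closure \<Omega>)"
    using cont assms(2) by (intro compact_continuous_image) (auto intro: continuous_on_subset)
  then obtain B where B: "\<And>y. y \<in> r ` closure \<Omega> \<Longrightarrow> norm y \<le> B" using compact_imp_bounded bounded_iff by metis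
  have "\<Omega> \<in> lmeasurable" using assms(1,2) by (simp add: lmeasurable_open)
  then interpret finite_measure "lebesgue_on \<Omega>" by (rule finite_measure_lebesgue_on)
  show ?thesis
  proof (rule integrable_const_bound[where B=B])
    show "AE x in lebesgue_on \<Omega>. norm (r x) \<le> B"
      using B closure_subset by (intro AE_I2) fastforce
    show "r \<in> borel_measurable (lebesgue_on \<Omega>)"
      using cont assms(1) by (intro continuous_imp_measurable_on_sets_lebesgue) (auto intro: continuous_on_subset)
  qed
qed

text \<open>The zero measure represents the symmetrised gradient, so rigid motions are admissible in
  \<open>TGV2\<close>.\<close>

lemma Ker_E_BD:
  assumes "open \<Omega>" "bounded \<Omega>" "r \<in> Ker_E"
  shows "r \<in> BD \<Omega>"
proof -
  have "represented_by \<Omega> (sym_grad \<Omega> r) (\<lambda>A. 0)"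
    using sym_grad_Ker_E[of \<Omega> r] assms
    by (simp add: represented_by_def vector_measure_def measure_integral_def)
  with Ker_E_integrable[OF assms] show ?thesis unfolding BD_def by blast
qed

lemma radon_norm_sym_grad_Ker_E:
  assumes "\<Omega> \<in> sets borel" "r \<in> Ker_E"
  shows "radon_norm \<Omega> (sym_grad \<Omega> r) = 0"
proof (rule antisym)
  show "radon_norm \<Omega> (sym_grad \<Omega> r) \<le> 0"
    unfolding radon_norm_def using sym_grad_Ker_E[OF assms] by (intro SUP_least) auto
  have "ereal (sym_grad \<Omega> r (\<lambda>x. 0)) \<le> radon_norm \<Omega> (sym_grad \<Omega> r)"
    unfolding radon_norm_def by (intro SUP_upper) (simp add: test_function_0)
  then show "0 \<le> radon_norm \<Omega> (sym_grad \<Omega> r)"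
    using sym_grad_Ker_E[OF assms test_function_0] by (simp add: zero_ereal_def)
qed


section \<open>The minimisation problem\<close>

lemma L1_norm_eq_integral:
  "integrable (lebesgue_on \<Omega>) f \<Longrightarrow> L1_norm \<Omega> f = ereal (LINT x|lebesgue_on \<Omega>. norm (f x))"
  unfolding L1_norm_def by (subst nn_integral_eq_integral) (auto simp: enn2ereal_ennreal)

lemma radon_norm_upper:
  "test_function \<Omega> v \<Longrightarrow> (\<And>x. norm (v x) \<le> 1) \<Longrightarrow> ereal (T v) \<le> radon_norm \<Omega> T"
  unfolding radon_norm_def by (rule SUP_upper) simp

text \<open>The zero test function competes in the supremum. Distributions are encoded as arbitrary
  functionals, so their value at it has to be given.\<close>

lemma radon_norm_nonneg: "T (\<lambda>x. 0) = 0 \<Longrightarrow> 0 \<le> radon_norm \<Omega> T"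
  using radon_norm_upper[OF test_function_0, where T=T and \<Omega>=\<Omega>] by (simp add: zero_ereal_def)

text \<open>The two functionals differ by the pairing of \<open>w - r\<close> with \<open>v\<close>,
  at most the L1 norm of \<open>w - r\<close> when \<bar>v\<bar> \<le> 1. Keeping the real L1 term
  on the right avoids subtracting extended reals.\<close>

lemma radon_norm_diff_fun_dist_le:
  fixes w r :: "real^'n \<Rightarrow> 'v::euclidean_space"
  assumes \<Omega>: "\<Omega> \<in> sets borel" and w: "integrable (lebesgue_on \<Omega>) w" and r: "integrable (lebesgue_on \<Omega>) r"
  shows "radon_norm \<Omega> (\<lambda>v. T v - fun_dist \<Omega> r v)
    \<le> radon_norm \<Omega> (\<lambda>v. T v - fun_dist \<Omega> w v) + ereal (LINT x|lebesgue_on \<Omega>. norm (w x - r x))"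
  unfolding radon_norm_def[of \<Omega> "\<lambda>v. T v - fun_dist \<Omega> r v"]
proof (rule SUP_least)
  fix v :: "real^'n \<Rightarrow> 'v" assume "v \<in> {v. test_function \<Omega> v \<and> (\<forall>x. norm (v x) \<le> 1)}"
  then have v: "test_function \<Omega> v" "\<And>x. norm (v x) \<le> 1" by auto
  note int = integrable_inner_test_function[OF \<Omega> w v(1)] integrable_inner_test_function[OF \<Omega> r v(1)]
  have "fun_dist \<Omega> w v - fun_dist \<Omega> r v = (LINT x|lebesgue_on \<Omega>. (w x - r x) \<bullet> v x)"
    unfolding fun_dist_def inner_diff_left using int by simp
  also have "\<dots> \<le> (LINT x|lebesgue_on \<Omega>. norm (w x - r x))"
  proof (rule integral_mono)
    show "(w x - r x) \<bullet> v x \<le> norm (w x - r x)" for x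
      using norm_cauchy_schwarz[of "w x - r x" "v x"] mult_left_mono[OF v(2)[of x], of "norm (w x - r x)"] by simp
  qed (use w r int in \<open>simp_all add: inner_diff_left\<close>)
  finally have "ereal (T v - fun_dist \<Omega> r v) \<le> ereal (T v - fun_dist \<Omega> w v) + ereal (LINT x|lebesgue_on \<Omega>. norm (w x - r x))"
    by simp
  also have "\<dots> \<le> radon_norm \<Omega> (\<lambda>v. T v - fun_dist \<Omega> w v) + ereal (LINT x|lebesgue_on \<Omega>. norm (w x - r x))"
    by (intro add_right_mono radon_norm_upper[where T="\<lambda>v. T v - fun_dist \<Omega> w v"] v)
  finally show "ereal (T v - fun_dist \<Omega> r v)
    \<le> radon_norm \<Omega> (\<lambda>v. T v - fun_dist \<Omega> w v) + ereal (LINT x|lebesgue_on \<Omega>. norm (w x - r x))" .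
qed

lemma dist_grad_0: "dist_grad \<Omega> u (\<lambda>x. 0) = 0"
  unfolding dist_grad_def partial_deriv_eq[OF has_derivative_const] by simp

lemma Ker_E_minimiser_minimises_radon_norm:
  assumes "open \<Omega>" "bounded \<Omega>" "u \<in> BV \<Omega>"
    and m: "is_Ker_E_minimiser \<Omega> (ac_gradient \<Omega> u) m" and r: "r \<in> Ker_E"
  shows "radon_norm \<Omega> (\<lambda>v. dist_grad \<Omega> u v - fun_dist \<Omega> m v) \<le> radon_norm \<Omega> (\<lambda>v. dist_grad \<Omega> u v - fun_dist \<Omega> r v)"
proof -
  have \<Omega>: "\<Omega> \<in> sets borel" using assms(1) by simp
  let ?g = "ac_gradient \<Omega> u"
  from ac_gradient[OF \<Omega> assms(3)] obtain M s where g: "integrable (lebesgue_on \<Omega>) ?g"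
    and M: "represented_by \<Omega> (dist_grad \<Omega> u) M" and s: "vector_measure \<Omega> s" "lebesgue_singular \<Omega> s"
    and Ms: "\<And>A. A \<in> borel_subsets \<Omega> \<Longrightarrow> M A = (LINT x|lebesgue_on A. ?g x) + s A"
    by blast
  have mK: "m \<in> Ker_E" using m unfolding is_Ker_E_minimiser_def by blast
  have int: "integrable (lebesgue_on \<Omega>) (\<lambda>x. ?g x - w x)" if "w \<in> Ker_E" for w
    using g Ker_E_integrable[OF assms(1,2) that] by simp
  have "L1_norm \<Omega> (\<lambda>x. ?g x - m x) \<le> L1_norm \<Omega> (\<lambda>x. ?g x - r x)"
    using m r unfolding is_Ker_E_minimiser_def by blast
  then have le: "(LINT x|lebesgue_on \<Omega>. norm (?g x - m x)) \<le> (LINT x|lebesgue_on \<Omega>. norm (?g x - r x))"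
    by (simp add: L1_norm_eq_integral int mK r)
  \<comment> \<open>Subtracting an integrable \<open>w\<close> alters only the density: the same
    \<open>s\<close> serves every \<open>w\<close>, as the comparison of Radon norms
    requires.\<close>
  have T: "dist_grad \<Omega> u v - fun_dist \<Omega> w v = (LINT x|lebesgue_on \<Omega>. (?g x - w x) \<bullet> v x) + measure_integral \<Omega> s v"
    if w: "w \<in> Ker_E" and v: "test_function \<Omega> v" for w v
  proof -
    have "dist_grad \<Omega> u v = (LINT x|lebesgue_on \<Omega>. ?g x \<bullet> v x) + measure_integral \<Omega> s v"
      using M v measure_integral_decompose[OF \<Omega> _ s(1) g Ms v] unfolding represented_by_def by simp
    then show ?thesis
      using integrable_inner_test_function[OF \<Omega> g v]
        integrable_inner_test_function[OF \<Omega> Ker_E_integrable[OF assms(1,2) w] v]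
      by (simp add: fun_dist_def inner_diff_left)
  qed
  show ?thesis
    by (rule radon_norm_mono_density[OF assms(1,2) int[OF mK] int[OF r] s le T[OF mK] T[OF r]])
qed

theorem corollary4:
  fixes \<Omega> :: "(real^'n) set" and C\<^sub>B\<^sub>D \<alpha> \<beta> :: real
    and u :: "real^'n \<Rightarrow> real" and m :: "real^'n \<Rightarrow> real^'n"
  assumes "open \<Omega>" and "bounded \<Omega>" and "connected \<Omega>" and "lipschitz_boundary \<Omega>"
    and "sobolev_korn_constant \<Omega> C\<^sub>B\<^sub>D"
    and "\<alpha> > 0" and "\<beta> > 0" and "\<beta> / \<alpha> > C\<^sub>B\<^sub>D"
    and "u \<in> BV \<Omega>"
    and "is_Ker_E_minimiser \<Omega> (ac_gradient \<Omega> u) m"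
  shows "TGV2 \<beta> \<alpha> \<Omega> u
    = ereal \<alpha> * radon_norm \<Omega> (\<lambda>v. dist_grad \<Omega> u v - fun_dist \<Omega> m v)"
  unfolding TGV2_def
proof (rule Least_equality)
  let ?R = "\<lambda>w. radon_norm \<Omega> (\<lambda>v. dist_grad \<Omega> u v - fun_dist \<Omega> w v)"
  let ?E = "\<lambda>w. radon_norm \<Omega> (sym_grad \<Omega> w)"
  have \<Omega>: "\<Omega> \<in> sets borel" using assms(1) by simp
  have m: "m \<in> Ker_E" using assms(10) unfolding is_Ker_E_minimiser_def by blast
  \<comment> \<open>The competitor \<open>m\<close> attains the value, since its symmetrised
    gradient has norm 0.\<close>
  show "\<exists>w\<in>BD \<Omega>. ereal \<alpha> * ?R m = ereal \<alpha> * ?R w + ereal \<beta> * ?E w"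
    using Ker_E_BD[OF assms(1,2) m] radon_norm_sym_grad_Ker_E[OF \<Omega> m] by (intro bexI[of _ m]) auto
  fix t assume "\<exists>w\<in>BD \<Omega>. t = ereal \<alpha> * ?R w + ereal \<beta> * ?E w"
  then obtain w where w: "w \<in> BD \<Omega>" and t: "t = ereal \<alpha> * ?R w + ereal \<beta> * ?E w" by blast
  obtain r where r: "r \<in> Ker_E" "L1_norm \<Omega> (\<lambda>x. w x - r x) \<le> ereal C\<^sub>B\<^sub>D * ?E w"
    using assms(5) w unfolding sobolev_korn_constant_def by blast
  have wi: "integrable (lebesgue_on \<Omega>) w" using w unfolding BD_def by blast
  have ri: "integrable (lebesgue_on \<Omega>) r" by (rule Ker_E_integrable[OF assms(1,2) r(1)])
  define L where "L = (LINT x|lebesgue_on \<Omega>. norm (w x - r x))"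
  have L: "ereal L \<le> ereal C\<^sub>B\<^sub>D * ?E w"
    using r(2) wi ri by (simp add: L1_norm_eq_integral L_def)
  have "?R m \<le> ?R r"
    by (rule Ker_E_minimiser_minimises_radon_norm[OF assms(1,2,9,10) r(1)])
  also have "\<dots> \<le> ?R w + ereal L"
    unfolding L_def by (rule radon_norm_diff_fun_dist_le[OF \<Omega> wi ri])
  finally have le: "?R m \<le> ?R w + ereal L" .
  \<comment> \<open>Nonnegativity of both norms rules out minus infinity, so \<open>t\<close> is
    infinite as soon as one of them is, and otherwise everything is real.\<close>
  have R0: "0 \<le> ?R w" by (rule radon_norm_nonneg) (simp add: dist_grad_0 fun_dist_def)
  \<comment> \<open>The value of \<open>sym_grad\<close> at the zero test function is read off from
    a representing measure, against which zero integrates to 0.\<close>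
  obtain M where "represented_by \<Omega> (sym_grad \<Omega> w) M" using w unfolding BD_def by blast
  then have "sym_grad \<Omega> w (\<lambda>x. 0) = measure_integral \<Omega> M (\<lambda>x. 0)"
    using test_function_0 unfolding represented_by_def by blast
  then have E0: "0 \<le> ?E w"
    by (intro radon_norm_nonneg) (simp add: measure_integral_def)
  have \<beta>: "\<alpha> * C\<^sub>B\<^sub>D \<le> \<beta>" using assms(6,8) by (simp add: field_simps)
  show "ereal \<alpha> * ?R m \<le> t"
  proof (cases "?E w = \<infinity> \<or> ?R w = \<infinity>")
    case True
    then have "t = \<infinity>" using R0 E0 assms(6,7) unfolding t by (cases "?R w"; cases "?E w") auto
    then show ?thesis by simp
  next
    case False
    then obtain R E where RE: "?R w = ereal R" "?E w = ereal E" using R0 E0 by (cases "?R w"; cases "?E w") auto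
    have "\<alpha> * L \<le> \<alpha> * (C\<^sub>B\<^sub>D * E)" using L assms(6) RE by simp
    also have "\<dots> \<le> \<beta> * E" using mult_right_mono[OF \<beta>, of E] E0 RE by (simp add: mult.assoc)
    finally have "\<alpha> * (R + L) \<le> \<alpha> * R + \<beta> * E" by (simp add: distrib_left)
    moreover have "ereal \<alpha> * ?R m \<le> ereal \<alpha> * (ereal R + ereal L)"
      using le assms(6) unfolding RE by (intro ereal_mult_left_mono) auto
    ultimately show ?thesis unfolding t RE by (simp add: order_trans)
  qed
qed

end
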